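(* There exists an automaton group $G$ whose Engel problem is undecidable; that is, there is an automaton group $G$ with a finite generating set $S$ closed under inverses such that there is no algorithm which, given words $v,w\in S^*$, decides whether there exists an integer $n\ge 1$ such that the $n$-iterated commutator $[\dots[[v,w],w],\dots,w]$ represents the identity of $G$.
   Context: A Mealy automaton is a tuple $(A,\Sigma,\delta,\sigma)$ where $A$ (the states) and $\Sigma$ (the alphabet) are finite sets, and $\delta\colon A\times\Sigma\to A$, $\sigma\colon A\times\Sigma\to\Sigma$ are maps. For $p\in A$ let $\sigma_p\colon\Sigma^*\to\Sigma^*$ be the length-preserving map defined recursively by $\sigma_p(\text{empty word})=\text{empty word}$ and $\sigma_p(xy)=\sigma(p,x)\,\sigma_{\delta(p,x)}(y)$ for $x\in\Sigma$, $y\in\Sigma^*$. If all $\sigma_p$ ($p\in A$) are bijective, the group generated by the automaton is the subgroup of $\mathrm{Aut}(\Sigma^* )$ generated by all $\sigma_p$, $p\in A$. An automaton group is a group generated by a Mealy automaton. The commutator is $[g,h]=g^{-1}h^{-1}gh$; the $n$-iterated commutator is $g_n$ where $g_0=g$ and $g_{i+1}=[g_i,h]$. $S^*$ denotes the set of finite words over $S$. The decidability of the Engel problem does not depend on the choice of the finite generating set. *)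

theory Defs
  imports "HOL-Algebra.Bij" "HOL-Algebra.Generated_Groups" "HOL-Library.Sublist" "HOL-Library.Nat_Bijection"
begin

section \<open>Mealy automata and the groups they generate\<close>

record ('a, 's) mealy =
  states :: "'a set"
  alphabet :: "'s set"
  delta :: "'a \<Rightarrow> 's \<Rightarrow> 'a"
  sigma :: "'a \<Rightarrow> 's \<Rightarrow> 's"

definition mealy_automaton :: "('a, 's) mealy \<Rightarrow> bool" where
  "mealy_automaton M \<longleftrightarrow>
     finite (states M) \<and> finite (alphabet M) \<and>
     (\<forall>p\<in>states M. \<forall>x\<in>alphabet M. delta M p x \<in> states M \<and> sigma M p x \<in> alphabet M)"

primrec act :: "('a, 's) mealy \<Rightarrow> 'a \<Rightarrow> 's list \<Rightarrow> 's list" where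
  "act M p [] = []"
| "act M p (x # y) = sigma M p x # act M (delta M p x) y"

definition invertible_mealy :: "('a, 's) mealy \<Rightarrow> bool" where
  "invertible_mealy M \<longleftrightarrow>
     (\<forall>p\<in>states M. bij_betw (act M p) (lists (alphabet M)) (lists (alphabet M)))"

text \<open>
  The words over an alphabet \<open>X\<close> form a rooted tree, ordered by the prefix relation. Its
  automorphism group is a subgroup of \<^const>\<open>BijGroup\<close>, whose product is composition of maps
  and whose elements are \<^const>\<open>undefined\<close> outside \<open>lists X\<close>.
\<close>

definition tree_automorphisms :: "'s set \<Rightarrow> ('s list \<Rightarrow> 's list) set" where
  "tree_automorphisms X =
     {f \<in> Bij (lists X). \<forall>u\<in>lists X. \<forall>v\<in>lists X. prefix (f u) (f v) \<longleftrightarrow> prefix u v}"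

definition tree_Aut :: "'s set \<Rightarrow> ('s list \<Rightarrow> 's list) monoid" where
  "tree_Aut X = (BijGroup (lists X))\<lparr>carrier := tree_automorphisms X\<rparr>"

definition state_maps :: "('a, 's) mealy \<Rightarrow> ('s list \<Rightarrow> 's list) set" where
  "state_maps M = (\<lambda>p. restrict (act M p) (lists (alphabet M))) ` states M"

definition automaton_group :: "('a, 's) mealy \<Rightarrow> ('s list \<Rightarrow> 's list) monoid" where
  "automaton_group M =
     (tree_Aut (alphabet M))\<lparr>carrier := generate (tree_Aut (alphabet M)) (state_maps M)\<rparr>"

lemma subgroup_tree_automorphisms: "subgroup (tree_automorphisms X) (BijGroup (lists X))"
proof (rule group.subgroupI[OF group_BijGroup])
  show "tree_automorphisms X \<subseteq> carrier (BijGroup (lists X))"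
    by (auto simp: tree_automorphisms_def BijGroup_def)
  have "(\<lambda>x\<in>lists X. x) \<in> tree_automorphisms X"
    using id_Bij[of "lists X"] by (auto simp: tree_automorphisms_def)
  then show "tree_automorphisms X \<noteq> {}" by blast
next
  fix f assume f: "f \<in> tree_automorphisms X"
  then have fB: "f \<in> Bij (lists X)" by (simp add: tree_automorphisms_def)
  then have bij: "bij_betw f (lists X) (lists X)" by (simp add: Bij_def)
  let ?g = "\<lambda>x\<in>lists X. inv_into (lists X) f x"
  have "prefix (?g u) (?g v) \<longleftrightarrow> prefix u v" if u: "u \<in> lists X" and v: "v \<in> lists X" for u v
  proof -
    have img: "f ` lists X = lists X" using bij by (simp add: bij_betw_def)
    have m: "inv_into (lists X) f w \<in> lists X" "f (inv_into (lists X) f w) = w"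
      if "w \<in> lists X" for w
      using inv_into_into[of w f "lists X"] f_inv_into_f[of w f "lists X"] that
      unfolding img by blast+
    have "prefix (f (inv_into (lists X) f u)) (f (inv_into (lists X) f v)) \<longleftrightarrow>
        prefix (inv_into (lists X) f u) (inv_into (lists X) f v)"
      using f m(1)[OF u] m(1)[OF v] unfolding tree_automorphisms_def by blast
    then show ?thesis using m(2)[OF u] m(2)[OF v] u v by (simp del: in_lists_conv_set)
  qed
  moreover have "?g \<in> Bij (lists X)" using fB by (rule restrict_inv_into_Bij)
  ultimately show "inv\<^bsub>BijGroup (lists X)\<^esub> f \<in> tree_automorphisms X"
    using inv_BijGroup[OF fB] by (simp add: tree_automorphisms_def)
next
  fix f g assume f: "f \<in> tree_automorphisms X" and g: "g \<in> tree_automorphisms X"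
  then have B: "f \<in> Bij (lists X)" "g \<in> Bij (lists X)"
    by (simp_all add: tree_automorphisms_def)
  have "g u \<in> lists X" if "u \<in> lists X" for u
    using B(2) that by (auto simp: Bij_def bij_betw_def)
  with f g B show "f \<otimes>\<^bsub>BijGroup (lists X)\<^esub> g \<in> tree_automorphisms X"
    by (simp add: tree_automorphisms_def BijGroup_def compose_Bij compose_eq)
qed

lemma group_tree_Aut: "group (tree_Aut X)"
  unfolding tree_Aut_def
  by (rule subgroup.subgroup_is_group[OF subgroup_tree_automorphisms group_BijGroup])

lemma state_maps_tree_Aut:
  assumes "mealy_automaton M" "invertible_mealy M"
  shows "state_maps M \<subseteq> carrier (tree_Aut (alphabet M))"
proof -
  have len: "length (act M p w) = length w" for p w
    by (induction w arbitrary: p) auto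
  have app: "\<exists>z. act M p (u @ v) = act M p u @ z" for p u v
    by (induction u arbitrary: p) auto
  { fix p u v
    assume p: "p \<in> states M" and u: "u \<in> lists (alphabet M)" and v: "v \<in> lists (alphabet M)"
    have inj: "inj_on (act M p) (lists (alphabet M))"
      using assms(2) p by (auto simp: invertible_mealy_def bij_betw_def)
    have "prefix (act M p u) (act M p v)" if "prefix u v"
      using that app by (auto simp: prefix_def)
    moreover have "prefix u v" if pre: "prefix (act M p u) (act M p v)"
    proof -
      have le: "length u \<le> length v" using prefix_length_le[OF pre] len by simp
      let ?v' = "take (length u) v"
      obtain z where z: "act M p (?v' @ drop (length u) v) = act M p ?v' @ z"
        using app by blast
      have "length (act M p ?v') = length (act M p u)" using le len by simp
      moreover obtain y where "act M p v = act M p u @ y" using pre by (auto simp: prefix_def)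
      ultimately have "act M p u = act M p ?v'" using z by simp
      moreover have "?v' \<in> lists (alphabet M)" using v by (auto dest: in_set_takeD)
      ultimately have "u = ?v'" using inj u by (auto dest: inj_onD)
      then show ?thesis by (metis take_is_prefix)
    qed
    ultimately have "prefix (act M p u) (act M p v) \<longleftrightarrow> prefix u v" by blast
  } note * = this
  have "restrict (act M p) (lists (alphabet M)) \<in> Bij (lists (alphabet M))"
    if "p \<in> states M" for p
    using assms(2) that by (auto simp: invertible_mealy_def Bij_def cong: bij_betw_cong)
  then show ?thesis
    using * unfolding state_maps_def tree_Aut_def tree_automorphisms_def
    by (intro image_subsetI) (simp del: in_lists_conv_set)
qed

lemma group_automaton_group:
  assumes "mealy_automaton M" "invertible_mealy M"
  shows "group (automaton_group M)"
  unfolding automaton_group_def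
  by (intro subgroup.subgroup_is_group group_tree_Aut
        group.generate_is_subgroup[OF group_tree_Aut state_maps_tree_Aut[OF assms]])

section \<open>Computability\<close>

text \<open>Terms for the partial recursive functions. \<open>Mini f\<close> minimises over the first argument.\<close>

datatype recf = Zero | Succ | Proj nat | Comp recf "recf list" | Prec recf recf | Mini recf

inductive rec_eval :: "recf \<Rightarrow> nat list \<Rightarrow> nat \<Rightarrow> bool" where
  zero: "rec_eval Zero xs 0"
| succ: "rec_eval Succ [x] (Suc x)"
| proj: "i < length xs \<Longrightarrow> rec_eval (Proj i) xs (xs ! i)"
| comp: "list_all2 (\<lambda>g y. rec_eval g xs y) gs ys \<Longrightarrow> rec_eval f ys z \<Longrightarrow> rec_eval (Comp f gs) xs z"
| prim_0: "rec_eval f xs z \<Longrightarrow> rec_eval (Prec f g) (0 # xs) z"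
| prim_Suc: "rec_eval (Prec f g) (n # xs) r \<Longrightarrow> rec_eval g (n # r # xs) z \<Longrightarrow>
    rec_eval (Prec f g) (Suc n # xs) z"
| mini: "rec_eval f (n # xs) 0 \<Longrightarrow> (\<forall>i<n. \<exists>y. rec_eval f (i # xs) (Suc y)) \<Longrightarrow>
    rec_eval (Mini f) xs n"

inductive_cases rec_eval_elims:
  "rec_eval Zero xs y" "rec_eval Succ xs y" "rec_eval (Proj i) xs y" "rec_eval (Comp f gs) xs y"
  "rec_eval (Prec f g) (0 # xs) y" "rec_eval (Prec f g) (Suc n # xs) y" "rec_eval (Mini f) xs y"

lemma rec_eval_functional:
  "rec_eval f xs y \<Longrightarrow> rec_eval f xs z \<Longrightarrow> y = z"
proof (induction arbitrary: z rule: rec_eval.induct)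
  case (zero xs)
  then show ?case by (elim rec_eval_elims) simp
next
  case (succ x)
  then show ?case by (elim rec_eval_elims) simp
next
  case (proj i xs)
  from proj.prems show ?case by (elim rec_eval_elims) simp
next
  case (comp xs gs ys f y)
  from comp.prems obtain ys' where ys': "list_all2 (\<lambda>g y. rec_eval g xs y) gs ys'"
    and z: "rec_eval f ys' z" by (elim rec_eval_elims) blast
  have "ys = ys'"
  proof (rule nth_equalityI)
    show "length ys = length ys'"
      using comp.IH(1) ys' by (simp add: list_all2_lengthD[symmetric])
  next
    fix i assume "i < length ys"
    then show "ys ! i = ys' ! i"
      using list_all2_nthD2[OF comp.IH(1)] list_all2_nthD[OF ys', of i]
        list_all2_lengthD[OF comp.IH(1)] by simp
  qed
  with z comp.IH(2) show ?case by simp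
next
  case (prim_0 f xs y g)
  from prim_0.prems show ?case by (elim rec_eval_elims) (rule prim_0.IH)
next
  case (prim_Suc f g n xs r y)
  from prim_Suc.prems obtain r' where "rec_eval (Prec f g) (n # xs) r'" "rec_eval g (n # r' # xs) z"
    by (elim rec_eval_elims) blast
  with prim_Suc.IH show ?case by blast
next
  case (mini f n xs)
  from mini.prems have z: "rec_eval f (z # xs) 0" "\<forall>i<z. \<exists>y. rec_eval f (i # xs) (Suc y)"
    by (auto elim: rec_eval_elims)
  show ?case
  proof (rule linorder_cases[of n z])
    assume "n < z"
    then obtain y where "rec_eval f (n # xs) (Suc y)" using z(2) by blast
    from mini.IH(1)[OF this] show ?thesis by simp
  next
    assume "z < n"
    then obtain y where "\<forall>w. rec_eval f (z # xs) w \<longrightarrow> Suc y = w" using mini.IH(2) by blast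
    with z(1) show ?thesis by blast
  qed
qed

text \<open>
  Decidability of a binary relation between words over a finite alphabet \<open>A\<close>: some total
  recursive function computes its characteristic function. Letters are numbered by an
  injection \<open>c\<close>, and words are coded by the (primitive recursive) bijection
  \<^const>\<open>list_encode\<close>. As \<open>A\<close> is finite, the choice of \<open>c\<close> does not matter; for infinite \<open>A\<close>
  this would not be a sensible notion.
\<close>

definition decidable_word_rel :: "'a set \<Rightarrow> ('a list \<Rightarrow> 'a list \<Rightarrow> bool) \<Rightarrow> bool" where
  "decidable_word_rel A P \<longleftrightarrow>
     (\<exists>(c :: 'a \<Rightarrow> nat) f. inj_on c A \<and>
        (\<forall>v\<in>lists A. \<forall>w\<in>lists A.
           rec_eval f [list_encode (map c v), list_encode (map c w)] (if P v w then 1 else 0)))"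

section \<open>The Engel problem\<close>

definition commutator :: "('g, 'b) monoid_scheme \<Rightarrow> 'g \<Rightarrow> 'g \<Rightarrow> 'g" where
  "commutator G g h = inv\<^bsub>G\<^esub> g \<otimes>\<^bsub>G\<^esub> inv\<^bsub>G\<^esub> h \<otimes>\<^bsub>G\<^esub> g \<otimes>\<^bsub>G\<^esub> h"

primrec iterated_commutator :: "('g, 'b) monoid_scheme \<Rightarrow> 'g \<Rightarrow> 'g \<Rightarrow> nat \<Rightarrow> 'g" where
  "iterated_commutator G g h 0 = g"
| "iterated_commutator G g h (Suc i) = commutator G (iterated_commutator G g h i) h"

definition word_value :: "('g, 'b) monoid_scheme \<Rightarrow> 'g list \<Rightarrow> 'g" where
  "word_value G w = foldr (\<lambda>x y. x \<otimes>\<^bsub>G\<^esub> y) w \<one>\<^bsub>G\<^esub>"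

definition finite_symmetric_generating_set :: "('g, 'b) monoid_scheme \<Rightarrow> 'g set \<Rightarrow> bool" where
  "finite_symmetric_generating_set G A \<longleftrightarrow>
     finite A \<and> A \<subseteq> carrier G \<and> (\<forall>s\<in>A. inv\<^bsub>G\<^esub> s \<in> A) \<and> generate G A = carrier G"

definition engel_problem_decidable :: "('g, 'b) monoid_scheme \<Rightarrow> 'g set \<Rightarrow> bool" where
  "engel_problem_decidable G A \<longleftrightarrow>
     decidable_word_rel A
       (\<lambda>v w. \<exists>n\<ge>1. iterated_commutator G (word_value G v) (word_value G w) n = \<one>\<^bsub>G\<^esub>)"

end

(* The commutator with an involution h that swaps two subtrees is easy to iterate: if v acts as g on
   one of the two subtrees and trivially on the other, then [v,h] acts as g^-1 and g on them, and since
   h inverts [v,h], every further commutator with h squares and inverts. So [...[[v,h],h],...,h] dies out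
   if and only if the order of g is a power of 2.

   Counter machines are simulated by such orders. A configuration with control state q and registers
   R_i becomes g = s_q u^-1 t u, where s_q and t are involutions and u is a word that contains the letter
   a_i exactly 2^(R_i) times. The square of g fixes the first level of the tree; one of its sections is
   the element of the successor configuration, and all other nontrivial sections are conjugate to that
   one or are involutions. The conjugating word of the successor is u1^-1 u2 for two sections u1, u2 of u,
   in which each a_i is kept, erased, erased at every second occurrence, or turned into the inverse of a
   letter. This doubles, copies or halves the numbers of letters. A zero test is a parity test, since
   2^(R_i) is odd only for R_i = 0. As g itself is never trivial, its order is a power of 2 if
   and only if the machine halts.

   It remains to take a machine that runs a universal function on its input and halts if and only if
   the result is 0. If the Engel problem were decidable, then a program deciding it for the words of
   this machine could be fed with its own code. *)

theory Submission
  imports Defs "HOL-Library.Countable"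
begin

section \<open>Counter machines\<close>

text \<open>\<open>Cpy\<close> is primitive because the automaton can copy a register in one step;
  this spares the compiler the copying loops of a plain counter machine.\<close>

datatype ins = Inc nat nat | Cpy nat nat nat | Dec nat nat nat

fun step :: "ins list \<Rightarrow> nat \<times> (nat \<Rightarrow> nat) \<Rightarrow> nat \<times> (nat \<Rightarrow> nat)" where
  "step P (q, r) = (if q < length P then
     (case P ! q of
        Inc i q' \<Rightarrow> (q', r(i := Suc (r i)))
      | Cpy i j q' \<Rightarrow> (q', r(j := r i))
      | Dec i q' q'' \<Rightarrow> (if r i = 0 then (q', r) else (q'', r(i := r i - 1))))
     else (q, r))"

definition halts :: "ins list \<Rightarrow> nat \<times> (nat \<Rightarrow> nat) \<Rightarrow> bool" where
  "halts P c \<longleftrightarrow> (\<exists>k. length P \<le> fst ((step P ^^ k) c))"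

text \<open>One bound serves registers and jump targets alike: it makes the set of automaton states
  finite, and it lets these numbers be digits in any base above \<open>K\<close>.\<close>

fun ins_bound :: "nat \<Rightarrow> ins \<Rightarrow> bool" where
  "ins_bound K (Inc i q') = (i \<le> K \<and> q' \<le> K)"
| "ins_bound K (Cpy i j q') = (i \<le> K \<and> j \<le> K \<and> q' \<le> K)"
| "ins_bound K (Dec i q' q'') = (i \<le> K \<and> q' \<le> K \<and> q'' \<le> K)"

section \<open>Structured programs and their compilation\<close>

datatype com = CInc nat | CCpy nat nat | Seq com com | Loop nat com

text \<open>A round of \<open>Loop\<close> decrements the register before the body runs, as
  \<open>Dec\<close> does, so that one instruction at the head of the loop implements it.\<close>

inductive exec :: "com \<Rightarrow> (nat \<Rightarrow> nat) \<Rightarrow> (nat \<Rightarrow> nat) \<Rightarrow> bool" where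
  CInc: "exec (CInc i) R (R(i := Suc (R i)))"
| CCpy: "exec (CCpy i j) R (R(j := R i))"
| Seq: "exec c R R' \<Longrightarrow> exec d R' R'' \<Longrightarrow> exec (Seq c d) R R''"
| Loop_0: "R i = 0 \<Longrightarrow> exec (Loop i c) R R"
| Loop_Suc: "R i = Suc n \<Longrightarrow> exec c (R(i := n)) R' \<Longrightarrow> exec (Loop i c) R' R'' \<Longrightarrow>
    exec (Loop i c) R R''"

primrec com_size :: "com \<Rightarrow> nat" where
  "com_size (CInc i) = 1"
| "com_size (CCpy i j) = 1"
| "com_size (Seq c d) = com_size c + com_size d"
| "com_size (Loop i c) = Suc (com_size c)"

text \<open>\<open>p\<close> is the address of the first instruction, and \<open>q\<close> is the
  address at which execution continues afterwards.\<close>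

primrec flatten :: "com \<Rightarrow> nat \<Rightarrow> nat \<Rightarrow> ins list" where
  "flatten (CInc i) p q = [Inc i q]"
| "flatten (CCpy i j) p q = [Cpy i j q]"
| "flatten (Seq c d) p q = flatten c p (p + com_size c) @ flatten d (p + com_size c) q"
| "flatten (Loop i c) p q = Dec i q (Suc p) # flatten c (Suc p) p"

lemma length_flatten [simp]: "length (flatten c p q) = com_size c"
  by (induction c arbitrary: p q) auto

lemma funpow_step_trans:
  assumes "(step P ^^ k) x = y" "(step P ^^ l) y = z"
  shows "(step P ^^ (l + k)) x = z"
  using assms by (simp add: funpow_add)

text \<open>The code sits between arbitrary pieces \<open>A\<close> and \<open>B\<close>, because in
  the induction a subprogram runs inside the code of the enclosing program.\<close>

lemma flatten_exec:
  assumes "exec c R R'" "P = A @ flatten c (length A) q @ B"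
  shows "\<exists>k. (step P ^^ k) (length A, R) = (q, R')"
  using assms
proof (induction arbitrary: A q B rule: exec.induct)
  case (CInc i R)
  then show ?case by (intro exI[of _ 1]) (simp add: fun_upd_def)
next
  case (CCpy i j R)
  then show ?case by (intro exI[of _ 1]) (simp add: fun_upd_def)
next
  case (Seq c R R' d R'')
  let ?m = "length A + com_size c"
  obtain k where k: "(step P ^^ k) (length A, R) = (?m, R')"
    using Seq.IH(1)[of A ?m "flatten d ?m q @ B"] Seq.prems by auto
  obtain l where "(step P ^^ l) (?m, R') = (q, R'')"
    using Seq.IH(2)[of "A @ flatten c (length A) ?m" q B] Seq.prems by auto
  from funpow_step_trans[OF k this] show ?case by blast
next
  case (Loop_0 R i c)
  then show ?case by (intro exI[of _ 1]) simp
next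
  case (Loop_Suc R i n c R' R'')
  have 1: "(step P ^^ 1) (length A, R) = (Suc (length A), R(i := n))"
    using Loop_Suc.prems Loop_Suc.hyps by simp
  obtain k where k: "(step P ^^ k) (Suc (length A), R(i := n)) = (length A, R')"
    using Loop_Suc.IH(1)[of "A @ [Dec i q (Suc (length A))]" "length A" B] Loop_Suc.prems
    by (auto simp del: fun_upd_apply)
  obtain l where "(step P ^^ l) (length A, R') = (q, R'')"
    using Loop_Suc.IH(2)[OF Loop_Suc.prems] by blast
  from funpow_step_trans[OF funpow_step_trans[OF 1 k] this] show ?case by blast
qed

section \<open>Compilation of partial recursive functions\<close>

text \<open>Register \<open>0\<close> holds the constant \<open>0\<close>; the registers from \<open>b\<close> on are scratch space.\<close>

definition computes :: "recf \<Rightarrow> nat list \<Rightarrow> nat \<Rightarrow> nat \<Rightarrow> com \<Rightarrow> bool" where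
  "computes f args out b c \<longleftrightarrow> (\<forall>R y. rec_eval f (map R args) y \<longrightarrow> R 0 = 0 \<longrightarrow>
     (\<exists>R'. exec c R R' \<and> R' out = y \<and> (\<forall>r<b. r \<noteq> out \<longrightarrow> R' r = R r)))"

lemma computesD:
  assumes "computes f args out b c" "rec_eval f (map R args) y" "R 0 = 0"
  obtains R' where "exec c R R'" "R' out = y" "\<And>r. r < b \<Longrightarrow> r \<noteq> out \<Longrightarrow> R' r = R r"
  using assms unfolding computes_def by blast

text \<open>A derivation for \<open>n\<close> contains derivations for all smaller arguments. They
  supply the intermediate values that the loop for \<open>Prec\<close> computes.\<close>

lemma rec_eval_Prec_le:
  assumes "rec_eval (Prec f g) (n # xs) y" "m \<le> n"
  shows "\<exists>z. rec_eval (Prec f g) (m # xs) z"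
  using assms
proof (induction n arbitrary: y)
  case (Suc n)
  show ?case
  proof (cases "m = Suc n")
    case False
    then have "m \<le> n" using Suc.prems by simp
    with Suc.prems(1) Suc.IH show ?thesis by (elim rec_eval_elims) blast
  qed (use Suc.prems in blast)
qed blast

text \<open>The results go into consecutive registers from \<open>s\<close> on. A program with
  output \<open>out\<close> may spoil only registers above \<open>out\<close>, so the arguments and
  the results already stored survive.\<close>

lemma ex_computes_list:
  assumes "\<And>g out. g \<in> set gs \<Longrightarrow> b \<le> out \<Longrightarrow> \<exists>c. computes g args out (Suc out) c"
    and "set args \<subseteq> {..<b}" "0 < b" "b \<le> s"
  shows "\<exists>c. \<forall>R ys. list_all2 (\<lambda>g y. rec_eval g (map R args) y) gs ys \<longrightarrow> R 0 = 0 \<longrightarrow>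
    (\<exists>R'. exec c R R' \<and> map R' [s..<s + length gs] = ys \<and> (\<forall>r<s. R' r = R r))"
  using assms(1,4)
proof (induction gs arbitrary: s)
  case Nil
  have "exec (CCpy 0 0) R R" for R using exec.CCpy[of 0 0 R] by simp
  then show ?case by (intro exI[of _ "CCpy 0 0"]) auto
next
  case (Cons g gs)
  obtain c where c: "computes g args s (Suc s) c" using Cons.prems(1)[of g s] Cons.prems(2) by auto
  have "\<exists>d. \<forall>R ys. list_all2 (\<lambda>g y. rec_eval g (map R args) y) gs ys \<longrightarrow> R 0 = 0 \<longrightarrow>
    (\<exists>R'. exec d R R' \<and> map R' [Suc s..<Suc s + length gs] = ys \<and> (\<forall>r<Suc s. R' r = R r))"
    by (rule Cons.IH) (simp_all add: Cons.prems le_SucI)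
  then obtain d where d: "\<forall>R ys. list_all2 (\<lambda>g y. rec_eval g (map R args) y) gs ys \<longrightarrow> R 0 = 0 \<longrightarrow>
    (\<exists>R'. exec d R R' \<and> map R' [Suc s..<Suc s + length gs] = ys \<and> (\<forall>r<Suc s. R' r = R r))" ..
  show ?case
  proof (intro exI[of _ "Seq c d"] allI impI)
    fix R ys assume all: "list_all2 (\<lambda>g y. rec_eval g (map R args) y) (g # gs) ys" and "R 0 = 0"
    then obtain y zs where ys: "ys = y # zs" and y: "rec_eval g (map R args) y"
      and zs: "list_all2 (\<lambda>g y. rec_eval g (map R args) y) gs zs"
      by (auto simp: list_all2_Cons1)
    obtain R' where R': "exec c R R'" "R' s = y" "\<And>r. r < Suc s \<Longrightarrow> r \<noteq> s \<Longrightarrow> R' r = R r"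
      using computesD[OF c y \<open>R 0 = 0\<close>] by metis
    have "map R' args = map R args" using assms(2) Cons.prems(2) R'(3) by fastforce
    moreover have "R' 0 = 0" using \<open>R 0 = 0\<close> R'(3)[of 0] Cons.prems(2) assms(3) by auto
    moreover have "list_all2 (\<lambda>g y. rec_eval g (map R' args) y) gs zs"
      using zs unfolding \<open>map R' args = map R args\<close> .
    ultimately obtain R'' where R'': "exec d R' R''" "map R'' [Suc s..<Suc s + length gs] = zs"
      "\<And>r. r < Suc s \<Longrightarrow> R'' r = R' r"
      using d by blast
    have "[s..<s + length (g # gs)] = s # [Suc s..<Suc s + length gs]"
      by (subst upt_conv_Cons) (simp_all del: upt_Suc)
    then have "map R'' [s..<s + length (g # gs)] = ys" using R'' R'(2) ys by (simp del: upt_Suc)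
    moreover have "\<forall>r<s. R'' r = R r" using R''(3) R'(3) by auto
    ultimately show "\<exists>R'. exec (Seq c d) R R' \<and> map R' [s..<s + length (g # gs)] = ys \<and> (\<forall>r<s. R' r = R r)"
      using exec.Seq[OF R'(1) R''(1)] by blast
  qed
qed

text \<open>Register \<open>b\<close> holds the current value, \<open>Suc b\<close> the recursion
  index, \<open>b + 2\<close> the number of remaining rounds, and \<open>b + 3\<close> receives the
  value of the next round. The invariant is that \<open>b\<close> contains the recursion's value at
  the index.\<close>

lemma exec_Prec_loop:
  assumes cg: "computes g (Suc b # b # as) (b + 3) (b + 4) c" and as: "set as \<subseteq> {..<b}" and b: "0 < b"
    and "R (b + 2) = n" "R 0 = 0" "rec_eval (Prec f g) (R (Suc b) # map R as) (R b)"
    "rec_eval (Prec f g) ((R (Suc b) + n) # map R as) y"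
  shows "\<exists>R'. exec (Loop (b + 2) (Seq c (Seq (CCpy (b + 3) b) (CInc (Suc b))))) R R' \<and> R' b = y \<and>
    (\<forall>r<b. R' r = R r)"
  using assms(4-)
proof (induction n arbitrary: R)
  case 0
  then have "R b = y" using rec_eval_functional by simp
  then show ?case using 0(1) exec.Loop_0 by blast
next
  case (Suc n)
  let ?R = "R(b + 2 := n)"
  have map1: "map ?R as = map R as" using as by fastforce
  obtain z where "rec_eval (Prec f g) (Suc (R (Suc b)) # map R as) z"
    using rec_eval_Prec_le[OF Suc.prems(4), of "Suc (R (Suc b))"] by auto
  then obtain r where "rec_eval (Prec f g) (R (Suc b) # map R as) r"
    "rec_eval g (R (Suc b) # r # map R as) z" and z: "rec_eval (Prec f g) (Suc (R (Suc b)) # map R as) z"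
    by (metis rec_eval_elims(6))
  then have "rec_eval g (map ?R (Suc b # b # as)) z"
    unfolding list.map map1 using rec_eval_functional[OF Suc.prems(3)] by simp
  from computesD[OF cg this] Suc.prems(2) b obtain R1 where R1: "exec c ?R R1" "R1 (b + 3) = z"
    "\<And>r. r < b + 4 \<Longrightarrow> r \<noteq> b + 3 \<Longrightarrow> R1 r = ?R r" by auto
  let ?R2 = "R1(b := z, Suc b := Suc (R1 (Suc b)))"
  have 2: "exec (Seq c (Seq (CCpy (b + 3) b) (CInc (Suc b)))) ?R ?R2"
    using exec.Seq[OF R1(1) exec.Seq[OF exec.CCpy[of "b + 3" b R1] exec.CInc[of "Suc b"]]] R1(2) by simp
  have lt: "\<forall>r<b. ?R2 r = R r" using R1(3) by auto
  have map2: "map ?R2 as = map R as" using lt as by fastforce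
  have val: "?R2 (Suc b) = Suc (R (Suc b))" "?R2 b = z" "?R2 (b + 2) = n" using R1(3) by simp_all
  have "\<exists>R'. exec (Loop (b + 2) (Seq c (Seq (CCpy (b + 3) b) (CInc (Suc b))))) ?R2 R' \<and> R' b = y \<and>
    (\<forall>r<b. R' r = ?R2 r)"
  proof (rule Suc.IH)
    show "?R2 (b + 2) = n" by (rule val(3))
    show "?R2 0 = 0" using lt b Suc.prems(2) by simp
    show "rec_eval (Prec f g) (?R2 (Suc b) # map ?R2 as) (?R2 b)"
      unfolding map2 val by (rule z)
    show "rec_eval (Prec f g) ((?R2 (Suc b) + n) # map ?R2 as) y"
      unfolding map2 val using Suc.prems(4) by simp
  qed
  then obtain R' where "exec (Loop (b + 2) (Seq c (Seq (CCpy (b + 3) b) (CInc (Suc b))))) ?R2 R'"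
    "R' b = y" "\<forall>r<b. R' r = ?R2 r" by blast
  then show ?case using exec.Loop_Suc[of R "b + 2" n, OF Suc.prems(1) 2] lt by metis
qed

text \<open>Register \<open>b\<close> holds the candidate and \<open>Suc b\<close> the value of
  \<open>f\<close> there; \<open>k\<close> is the distance to the minimum. The decrement that
  \<open>Loop\<close> performs is harmless, because the body recomputes
  \<open>Suc b\<close>.\<close>

lemma exec_Mini_loop:
  assumes cf: "computes f (b # args) (Suc b) (b + 2) c" and args: "set args \<subseteq> {..<b}" and b: "0 < b"
    and "R 0 = 0" "R b + k = n" "rec_eval f (R b # map R args) (R (Suc b))"
    and "rec_eval f (n # map R args) 0" "\<forall>i<n. \<exists>y. rec_eval f (i # map R args) (Suc y)"
  shows "\<exists>R'. exec (Loop (Suc b) (Seq (CInc b) c)) R R' \<and> R' b = n \<and> (\<forall>r<b. R' r = R r)"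
  using assms(4-)
proof (induction k arbitrary: R)
  case 0
  then have "R (Suc b) = 0" using rec_eval_functional by simp
  then show ?case using 0(2) exec.Loop_0 by auto
next
  case (Suc k)
  obtain m where m: "R (Suc b) = Suc m"
    using Suc.prems(2,3,5) rec_eval_functional by (metis less_add_same_cancel1 zero_less_Suc)
  let ?R = "R(Suc b := m, b := Suc (R b))"
  have map1: "map ?R args = map R args" using args by fastforce
  have "\<exists>z. rec_eval f (Suc (R b) # map R args) z"
    using Suc.prems(2,4,5) by (cases "Suc (R b) = n") (auto, metis Suc_lessI less_add_Suc1)
  then obtain z where z: "rec_eval f (Suc (R b) # map R args) z" by blast
  then have "rec_eval f (map ?R (b # args)) z" unfolding list.map map1 by simp
  from computesD[OF cf this] Suc.prems(1) b obtain R1 where R1: "exec c ?R R1" "R1 (Suc b) = z"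
    "\<And>r. r < b + 2 \<Longrightarrow> r \<noteq> Suc b \<Longrightarrow> R1 r = ?R r" by auto
  have 2: "exec (Seq (CInc b) c) (R(Suc b := m)) R1"
    using exec.Seq[OF exec.CInc[of b "R(Suc b := m)"]] R1(1) by simp
  have lt: "\<forall>r<b. R1 r = R r" using R1(3) by auto
  have map2: "map R1 args = map R args" using lt args by fastforce
  have "R1 b = Suc (R b)" using R1(3) by simp
  moreover have "R1 0 = 0" using lt b Suc.prems(1) by simp
  ultimately obtain R' where "exec (Loop (Suc b) (Seq (CInc b) c)) R1 R'" "R' b = n" "\<forall>r<b. R' r = R1 r"
    using Suc.IH[of R1] Suc.prems z R1(2) unfolding map2 by auto
  then show ?case using exec.Loop_Suc[of R "Suc b" m, OF m 2] lt by metis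
qed

text \<open>Induction on the term. Compound terms keep intermediate values in registers from
  \<open>b\<close> on and leave \<open>out\<close> to the last piece of the program, so
  \<open>out\<close> may be one of the arguments.\<close>

lemma ex_computes:
  assumes "set args \<subseteq> {..<b}" "0 < out" "out < b"
  shows "\<exists>c. computes f args out b c"
  using assms
proof (induction f arbitrary: args out b)
  case Zero
  have "computes Zero args out b (CCpy 0 out)"
    unfolding computes_def
  proof (intro allI impI)
    fix R :: "nat \<Rightarrow> nat" and y assume "rec_eval Zero (map R args) y" "R 0 = 0"
    then show "\<exists>R'. exec (CCpy 0 out) R R' \<and> R' out = y \<and> (\<forall>r<b. r \<noteq> out \<longrightarrow> R' r = R r)"
      using exec.CCpy[of 0 out R] by (elim rec_eval_elims) auto
  qed
  then show ?case by blast
next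
  case Succ
  \<comment> \<open>\<open>Succ\<close> evaluates only on one-element lists, where
    \<open>hd args\<close> is the argument.\<close>
  have "computes Succ args out b (Seq (CCpy (hd args) out) (CInc out))"
    unfolding computes_def
  proof (intro allI impI)
    fix R :: "nat \<Rightarrow> nat" and y assume "rec_eval Succ (map R args) y" "R 0 = 0"
    then obtain a where "args = [a]" "y = Suc (R a)" by (elim rec_eval_elims) auto
    then show "\<exists>R'. exec (Seq (CCpy (hd args) out) (CInc out)) R R' \<and> R' out = y \<and>
        (\<forall>r<b. r \<noteq> out \<longrightarrow> R' r = R r)"
      using exec.Seq[OF exec.CCpy[of a out R] exec.CInc[of out]] by auto
  qed
  then show ?case by blast
next
  case (Proj i)
  have "computes (Proj i) args out b (CCpy (args ! i) out)"
    unfolding computes_def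
  proof (intro allI impI)
    fix R :: "nat \<Rightarrow> nat" and y assume "rec_eval (Proj i) (map R args) y" "R 0 = 0"
    then show "\<exists>R'. exec (CCpy (args ! i) out) R R' \<and> R' out = y \<and> (\<forall>r<b. r \<noteq> out \<longrightarrow> R' r = R r)"
      using exec.CCpy[of "args ! i" out R] by (elim rec_eval_elims) auto
  qed
  then show ?case by blast
next
  case (Comp f gs)
  have "\<exists>c. computes g args out' (Suc out') c" if "g \<in> set gs" "b \<le> out'" for g out'
  proof (rule Comp.IH(2)[OF that(1)])
    show "set args \<subseteq> {..<Suc out'}" using Comp.prems(1) that(2) by fastforce
  qed (use Comp.prems that(2) in simp_all)
  then obtain d where d: "\<And>R ys. list_all2 (\<lambda>g y. rec_eval g (map R args) y) gs ys \<Longrightarrow> R 0 = 0 \<Longrightarrow>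
      \<exists>R'. exec d R R' \<and> map R' [b..<b + length gs] = ys \<and> (\<forall>r<b. R' r = R r)"
    using ex_computes_list[of gs b args b] Comp.prems by auto
  have "set [b..<b + length gs] \<subseteq> {..<b + length gs}" by auto
  then obtain c where c: "computes f [b..<b + length gs] out (b + length gs) c"
    using Comp.IH(1) Comp.prems by (meson trans_less_add1)
  have "computes (Comp f gs) args out b (Seq d c)"
    unfolding computes_def
  proof (intro allI impI)
    fix R :: "nat \<Rightarrow> nat" and y assume "rec_eval (Comp f gs) (map R args) y" "R 0 = 0"
    then obtain ys where ys: "list_all2 (\<lambda>g y. rec_eval g (map R args) y) gs ys" "rec_eval f ys y"
      by (elim rec_eval_elims) blast
    obtain R1 where R1: "exec d R R1" "map R1 [b..<b + length gs] = ys" "\<forall>r<b. R1 r = R r"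
      using d[OF ys(1) \<open>R 0 = 0\<close>] by blast
    have "rec_eval f (map R1 [b..<b + length gs]) y" "R1 0 = 0"
      using R1 ys(2) Comp.prems \<open>R 0 = 0\<close> by auto
    from computesD[OF c this] obtain R2 where "exec c R1 R2" "R2 out = y"
      "\<And>r. r < b + length gs \<Longrightarrow> r \<noteq> out \<Longrightarrow> R2 r = R1 r" by metis
    then show "\<exists>R'. exec (Seq d c) R R' \<and> R' out = y \<and> (\<forall>r<b. r \<noteq> out \<longrightarrow> R' r = R r)"
      using exec.Seq[OF R1(1)] R1(3) by (metis trans_less_add1)
  qed
  then show ?case by blast
next
  case (Prec f g)
  show ?case
  proof (cases args)
    case Nil
    \<comment> \<open>Without a recursion argument there is no value, so any program will
      do.\<close>
    have "\<not> rec_eval (Prec f g) [] y" for y by (auto elim: rec_eval.cases)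
    then show ?thesis using Nil by (auto simp: computes_def)
  next
    case (Cons a as)
    have as: "set as \<subseteq> {..<b}" "a < b" using Prec.prems Cons by auto
    have "set as \<subseteq> {..<Suc b}" "set (Suc b # b # as) \<subseteq> {..<b + 4}" using as by fastforce+
    then obtain c d where c: "computes f as b (Suc b) c"
      and d: "computes g (Suc b # b # as) (b + 3) (b + 4) d"
      using Prec.IH(1)[of as "Suc b" b] Prec.IH(2)[of "Suc b # b # as" "b + 4" "b + 3"] Prec.prems
      by (auto simp del: set_simps)
    let ?L = "Loop (b + 2) (Seq d (Seq (CCpy (b + 3) b) (CInc (Suc b))))"
    have "computes (Prec f g) args out b
        (Seq c (Seq (CCpy 0 (Suc b)) (Seq (CCpy a (b + 2)) (Seq ?L (CCpy b out)))))"
      unfolding computes_def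
    proof (intro allI impI)
      fix R :: "nat \<Rightarrow> nat" and y assume e: "rec_eval (Prec f g) (map R args) y" "R 0 = 0"
      then have ev: "rec_eval (Prec f g) (R a # map R as) y" using Cons by simp
      then obtain z where z: "rec_eval (Prec f g) (0 # map R as) z" using rec_eval_Prec_le by blast
      then have "rec_eval f (map R as) z" by (elim rec_eval_elims)
      from computesD[OF c this e(2)] obtain R1 where R1: "exec c R R1" "R1 b = z"
        "\<And>r. r < b \<Longrightarrow> R1 r = R r" by (metis less_Suc_eq nat_neq_iff)
      let ?R2 = "R1(Suc b := 0, b + 2 := R1 a)"
      have "R1 0 = 0" using R1(3)[of 0] e(2) Prec.prems by auto
      then have 2: "exec (CCpy 0 (Suc b)) R1 (R1(Suc b := 0))" using exec.CCpy[of 0 "Suc b" R1] by simp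
      have 3: "exec (CCpy a (b + 2)) (R1(Suc b := 0)) ?R2"
        using exec.CCpy[of a "b + 2" "R1(Suc b := 0)"] as by simp
      have lt: "\<forall>r<b. ?R2 r = R r" using R1(3) by auto
      have map2: "map ?R2 as = map R as" using lt as by fastforce
      have "\<exists>R'. exec ?L ?R2 R' \<and> R' b = y \<and> (\<forall>r<b. R' r = ?R2 r)"
      proof (rule exec_Prec_loop[OF d as(1)])
        show "rec_eval (Prec f g) ((?R2 (Suc b) + R1 a) # map ?R2 as) y"
          using ev R1(3)[OF as(2)] unfolding map2 by simp
        show "rec_eval (Prec f g) (?R2 (Suc b) # map ?R2 as) (?R2 b)"
          using z R1(2) unfolding map2 by simp
      qed (use \<open>R1 0 = 0\<close> Prec.prems in auto)
      then obtain R3 where R3: "exec ?L ?R2 R3" "R3 b = y" "\<forall>r<b. R3 r = ?R2 r" by blast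
      show "\<exists>R'. exec (Seq c (Seq (CCpy 0 (Suc b)) (Seq (CCpy a (b + 2)) (Seq ?L (CCpy b out))))) R R' \<and>
          R' out = y \<and> (\<forall>r<b. r \<noteq> out \<longrightarrow> R' r = R r)"
      proof (intro exI conjI)
        show "exec (Seq c (Seq (CCpy 0 (Suc b)) (Seq (CCpy a (b + 2)) (Seq ?L (CCpy b out))))) R (R3(out := R3 b))"
          by (rule exec.Seq[OF R1(1) exec.Seq[OF 2 exec.Seq[OF 3 exec.Seq[OF R3(1) exec.CCpy]]]])
      qed (use R3 lt in simp_all)
    qed
    then show ?thesis by blast
  qed
next
  case (Mini f)
  have "set (b # args) \<subseteq> {..<b + 2}" using Mini.prems by fastforce
  then obtain c where c: "computes f (b # args) (Suc b) (b + 2) c"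
    using Mini.IH[of "b # args" "b + 2" "Suc b"] by auto
  let ?L = "Loop (Suc b) (Seq (CInc b) c)"
  have "computes (Mini f) args out b (Seq (CCpy 0 b) (Seq c (Seq ?L (CCpy b out))))"
    unfolding computes_def
  proof (intro allI impI)
    fix R :: "nat \<Rightarrow> nat" and n assume "rec_eval (Mini f) (map R args) n" and R0: "R 0 = 0"
    then have n: "rec_eval f (n # map R args) 0" "\<forall>i<n. \<exists>y. rec_eval f (i # map R args) (Suc y)"
      by (auto elim: rec_eval_elims)
    let ?R = "R(b := 0)"
    have 1: "exec (CCpy 0 b) R ?R" using exec.CCpy[of 0 b R] R0 by simp
    have map1: "map ?R args = map R args" using Mini.prems by fastforce
    obtain z where z: "rec_eval f (0 # map R args) z" using n by (cases n) auto
    then have "rec_eval f (map ?R (b # args)) z" unfolding list.map map1 by simp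
    from computesD[OF c this] R0 Mini.prems obtain R1 where R1: "exec c ?R R1" "R1 (Suc b) = z"
      "\<And>r. r < b + 2 \<Longrightarrow> r \<noteq> Suc b \<Longrightarrow> R1 r = ?R r" by auto
    have lt: "\<forall>r<b. R1 r = R r" using R1(3) by auto
    have map2: "map R1 args = map R args" using lt Mini.prems by fastforce
    have R1b: "R1 b = 0" using R1(3)[of b] by simp
    have "\<exists>R'. exec ?L R1 R' \<and> R' b = n \<and> (\<forall>r<b. R' r = R1 r)"
    proof (rule exec_Mini_loop[OF c, where k = n], unfold map2 R1b R1(2))
      show "R1 0 = 0" using lt R0 Mini.prems by auto
    qed (use Mini.prems z n in auto)
    then obtain R2 where R2: "exec ?L R1 R2" "R2 b = n" "\<forall>r<b. R2 r = R1 r" by blast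
    show "\<exists>R'. exec (Seq (CCpy 0 b) (Seq c (Seq ?L (CCpy b out)))) R R' \<and>
        R' out = n \<and> (\<forall>r<b. r \<noteq> out \<longrightarrow> R' r = R r)"
    proof (intro exI conjI)
      show "exec (Seq (CCpy 0 b) (Seq c (Seq ?L (CCpy b out)))) R (R2(out := R2 b))"
        by (rule exec.Seq[OF 1 exec.Seq[OF R1(1) exec.Seq[OF R2(1) exec.CCpy]]])
    qed (use R2 lt in simp_all)
  qed
  then show ?case by blast
qed

section \<open>A universal function\<close>

definition recursive :: "nat \<Rightarrow> (nat list \<Rightarrow> nat) \<Rightarrow> bool" where
  "recursive n F \<longleftrightarrow> (\<exists>f. \<forall>xs. length xs = n \<longrightarrow> rec_eval f xs (F xs))"

lemma recursive_cong:
  assumes "recursive n F" "\<And>xs. length xs = n \<Longrightarrow> F xs = G xs"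
  shows "recursive n G"
  using assms unfolding recursive_def by auto

lemma recursive_nth: "i < n \<Longrightarrow> recursive n (\<lambda>xs. xs ! i)"
  unfolding recursive_def by (auto intro!: exI[of _ "Proj i"] rec_eval.proj)

lemma recursive_comp:
  assumes "recursive m G" "length Fs = m" "\<forall>F\<in>set Fs. recursive n F"
  shows "recursive n (\<lambda>xs. G (map (\<lambda>F. F xs) Fs))"
proof -
  obtain g where g: "\<And>xs. length xs = m \<Longrightarrow> rec_eval g xs (G xs)"
    using assms(1) unfolding recursive_def by blast
  obtain h where h: "\<And>F xs. F \<in> set Fs \<Longrightarrow> length xs = n \<Longrightarrow> rec_eval (h F) xs (F xs)"
    using assms(3) unfolding recursive_def by metis
  have "rec_eval (Comp g (map h Fs)) xs (G (map (\<lambda>F. F xs) Fs))" if "length xs = n" for xs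
    by (rule rec_eval.comp[where ys = "map (\<lambda>F. F xs) Fs"])
      (use h that g assms(2) in \<open>auto simp: list_all2_conv_all_nth\<close>)
  then show ?thesis unfolding recursive_def by blast
qed

lemma recursive_op1:
  assumes "recursive 1 (\<lambda>xs. h (xs ! 0))" "recursive n F"
  shows "recursive n (\<lambda>xs. h (F xs))"
  using recursive_comp[OF assms(1), of "[F]" n] assms(2) by simp

lemma recursive_op2:
  assumes "recursive 2 (\<lambda>xs. h (xs ! 0) (xs ! 1))" "recursive n F" "recursive n G"
  shows "recursive n (\<lambda>xs. h (F xs) (G xs))"
  using recursive_comp[OF assms(1), of "[F, G]" n] assms(2,3) by simp

lemma recursive_op4:
  assumes "recursive 4 (\<lambda>xs. h (xs ! 0) (xs ! 1) (xs ! 2) (xs ! 3))"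
    "recursive n F" "recursive n G" "recursive n H" "recursive n I"
  shows "recursive n (\<lambda>xs. h (F xs) (G xs) (H xs) (I xs))"
  using recursive_comp[OF assms(1), of "[F, G, H, I]" n] assms(2-) by simp

lemma recursive_Suc: "recursive n F \<Longrightarrow> recursive n (\<lambda>xs. Suc (F xs))"
proof (rule recursive_op1[where h = Suc])
  have "rec_eval Succ xs (Suc (xs ! 0))" if "length xs = 1" for xs
    using that rec_eval.succ by (cases xs) auto
  then show "recursive 1 (\<lambda>xs. Suc (xs ! 0))" unfolding recursive_def by blast
qed

lemma recursive_const: "recursive n (\<lambda>xs. c)"
proof (induction c)
  case 0
  show ?case unfolding recursive_def using rec_eval.zero by blast
qed (rule recursive_Suc)

lemma recursive_prec:
  assumes "recursive n F" "recursive (Suc (Suc n)) G"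
    and "\<And>ys. length ys = n \<Longrightarrow> h 0 ys = F ys"
    and "\<And>k ys. length ys = n \<Longrightarrow> h (Suc k) ys = G (k # h k ys # ys)"
  shows "recursive (Suc n) (\<lambda>xs. h (xs ! 0) (tl xs))"
proof -
  obtain f where f: "\<And>xs. length xs = n \<Longrightarrow> rec_eval f xs (F xs)"
    using assms(1) unfolding recursive_def by blast
  obtain g where g: "\<And>xs. length xs = Suc (Suc n) \<Longrightarrow> rec_eval g xs (G xs)"
    using assms(2) unfolding recursive_def by blast
  have *: "rec_eval (Prec f g) (k # ys) (h k ys)" if "length ys = n" for k ys
  proof (induction k)
    case 0
    show ?case using f[OF that] assms(3)[OF that] by (auto intro: rec_eval.prim_0)
  next
    case (Suc k)
    show ?case
      by (rule rec_eval.prim_Suc[OF Suc]) (use g[of "k # h k ys # ys"] that assms(4) in simp)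
  qed
  have "rec_eval (Prec f g) xs (h (xs ! 0) (tl xs))" if "length xs = Suc n" for xs
    using that * by (cases xs) auto
  then show ?thesis unfolding recursive_def by blast
qed

lemma recursive_prec1:
  assumes "recursive 2 (\<lambda>xs. g (xs ! 0) (xs ! 1))"
    and "\<And>k. h (Suc k) = g k (h k)"
    and "recursive n X"
  shows "recursive n (\<lambda>xs. h (X xs))"
proof (rule recursive_op1[where h = h, OF _ assms(3)])
  have "recursive (Suc 0) (\<lambda>xs. (\<lambda>k ys. h k) (xs ! 0) (tl xs))"
    by (rule recursive_prec[where F = "\<lambda>_. h 0" and G = "\<lambda>xs. g (xs ! 0) (xs ! 1)"])
      (use assms in \<open>simp_all add: recursive_const numeral_2_eq_2\<close>)
  then show "recursive 1 (\<lambda>xs. h (xs ! 0))" by simp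
qed

lemma recursive_prec2:
  assumes "recursive 1 (\<lambda>xs. f (xs ! 0))" "recursive 3 (\<lambda>xs. g (xs ! 0) (xs ! 1) (xs ! 2))"
    and "\<And>y. h 0 y = f y" "\<And>k y. h (Suc k) y = g k (h k y) y"
    and "recursive n X" "recursive n Y"
  shows "recursive n (\<lambda>xs. h (X xs) (Y xs))"
proof (rule recursive_op2[where h = h, OF _ assms(5,6)])
  have "recursive (Suc 1) (\<lambda>xs. (\<lambda>k ys. h k (ys ! 0)) (xs ! 0) (tl xs))"
    by (rule recursive_prec[where F = "\<lambda>xs. f (xs ! 0)" and G = "\<lambda>xs. g (xs ! 0) (xs ! 1) (xs ! 2)"])
      (use assms in \<open>simp_all add: numeral_3_eq_3 numeral_2_eq_2\<close>)
  then have "recursive 2 (\<lambda>xs. h (xs ! 0) (tl xs ! 0))" by (simp add: numeral_2_eq_2)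
  then show "recursive 2 (\<lambda>xs. h (xs ! 0) (xs ! 1))"
    by (rule recursive_cong) (simp add: nth_tl)
qed

named_theorems recursive_intros

lemmas [recursive_intros] = recursive_const recursive_nth recursive_Suc

lemma recursive_add [recursive_intros]:
  "recursive n X \<Longrightarrow> recursive n Y \<Longrightarrow> recursive n (\<lambda>xs. X xs + Y xs)"
  by (rule recursive_prec2[where h = "(+)" and f = "\<lambda>y. y" and g = "\<lambda>k r y. Suc r"])
    (simp_all add: recursive_intros)

lemma recursive_mult [recursive_intros]:
  "recursive n X \<Longrightarrow> recursive n Y \<Longrightarrow> recursive n (\<lambda>xs. X xs * Y xs)"
  by (rule recursive_prec2[where h = "(*)" and f = "\<lambda>y. 0" and g = "\<lambda>k r y. y + r"])
    (simp_all add: recursive_intros)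

text \<open>The recursion runs over the subtrahend and iterates the predecessor, hence the exchanged
  arguments.\<close>

lemma recursive_diff [recursive_intros]:
  assumes "recursive n X" "recursive n Y"
  shows "recursive n (\<lambda>xs. X xs - Y xs)"
proof -
  have pred: "recursive m F \<Longrightarrow> recursive m (\<lambda>xs. F xs - 1)" for m F
    by (rule recursive_prec1[where h = "\<lambda>k. k - 1" and g = "\<lambda>k r. k"])
      (simp_all add: recursive_intros)
  have "recursive 3 (\<lambda>xs. xs ! 1 - 1)"
    by (rule pred) (rule recursive_nth, simp)
  then show ?thesis
    by (intro recursive_prec2[where h = "\<lambda>k y. y - k" and f = "\<lambda>y. y" and g = "\<lambda>k r y. r - 1",
          OF recursive_nth _ _ _ assms(2,1)]) simp_all
qed

lemma recursive_power [recursive_intros]: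
  "recursive n X \<Longrightarrow> recursive n Y \<Longrightarrow> recursive n (\<lambda>xs. X xs ^ Y xs)"
  by (rule recursive_prec2[where h = "\<lambda>k y. y ^ k" and f = "\<lambda>y. 1" and g = "\<lambda>k r y. y * r"])
    (simp_all add: recursive_intros)

text \<open>Truncated subtraction makes \<open>1 - X\<close> the indicator of
  \<open>X = 0\<close>.\<close>

lemma recursive_if_0:
  assumes "recursive n X" "recursive n Y" "recursive n Z"
  shows "recursive n (\<lambda>xs. if X xs = 0 then Y xs else Z xs)"
proof (rule recursive_cong)
  show "recursive n (\<lambda>xs. (1 - X xs) * Y xs + (1 - (1 - X xs)) * Z xs)"
    using assms by (intro recursive_intros)
qed auto

lemma recursive_if_eq [recursive_intros]:
  assumes "recursive n V" "recursive n X" "recursive n Y" "recursive n Z"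
  shows "recursive n (\<lambda>xs. if V xs = X xs then Y xs else Z xs)"
proof (rule recursive_cong)
  show "recursive n (\<lambda>xs. if (V xs - X xs) + (X xs - V xs) = 0 then Y xs else Z xs)"
    using assms by (intro recursive_if_0 recursive_intros)
qed auto

lemma recursive_mod [recursive_intros]:
  "recursive n X \<Longrightarrow> recursive n Y \<Longrightarrow> recursive n (\<lambda>xs. X xs mod Y xs)"
  by (rule recursive_prec2[where h = "(mod)" and f = "\<lambda>y. 0"
        and g = "\<lambda>k r y. if Suc r = y then 0 else Suc r"])
    (simp_all add: recursive_intros mod_Suc)

lemma recursive_div [recursive_intros]:
  "recursive n X \<Longrightarrow> recursive n Y \<Longrightarrow> recursive n (\<lambda>xs. X xs div Y xs)"
  by (rule recursive_prec2[where h = "(div)" and f = "\<lambda>y. 0"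
        and g = "\<lambda>k r y. if Suc k mod y = 0 then Suc r else r"])
    (simp_all add: recursive_intros div_Suc)

lemma recursive_prod_encode [recursive_intros]:
  assumes "recursive n X" "recursive n Y"
  shows "recursive n (\<lambda>xs. prod_encode (X xs, Y xs))"
proof -
  have "recursive n (\<lambda>xs. triangle (X xs + Y xs))"
    by (rule recursive_prec1[where h = triangle and g = "\<lambda>k r. r + Suc k"])
      (use assms in \<open>simp_all add: recursive_intros\<close>)
  then show ?thesis using assms unfolding prod_encode_def prod.case by (intro recursive_intros)
qed

section \<open>Positional codes of programs and configurations\<close>

definition digit :: "nat \<Rightarrow> nat \<Rightarrow> nat \<Rightarrow> nat" where
  "digit z b k = z div b ^ k mod b"

lemma recursive_digit [recursive_intros]:
  "recursive n X \<Longrightarrow> recursive n Y \<Longrightarrow> recursive n Z \<Longrightarrow>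
    recursive n (\<lambda>xs. digit (X xs) (Y xs) (Z xs))"
  unfolding digit_def by (intro recursive_intros)

text \<open>Induction on the position: as \<open>C 0 < b\<close>, division by \<open>b\<close>
  strips the lowest digit and shifts the others down.\<close>

lemma digit_sum:
  assumes "\<And>r. r < m \<Longrightarrow> C r < b" "0 < b"
  shows "digit (\<Sum>r<m. C r * b ^ r) b k = (if k < m then C k else 0)"
  using assms(1)
proof (induction k arbitrary: m C)
  case 0
  show ?case
  proof (cases m)
    case (Suc l)
    then have "(\<Sum>r<m. C r * b ^ r) = C 0 + b * (\<Sum>r<l. C (Suc r) * b ^ r)"
      by (simp add: sum.lessThan_Suc_shift sum_distrib_left mult_ac del: sum.lessThan_Suc)
    then show ?thesis using 0[of 0] Suc by (simp add: digit_def)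
  qed (simp add: digit_def)
next
  case (Suc k)
  show ?case
  proof (cases m)
    case m: (Suc l)
    then have "(\<Sum>r<m. C r * b ^ r) = C 0 + b * (\<Sum>r<l. C (Suc r) * b ^ r)"
      by (simp add: sum.lessThan_Suc_shift sum_distrib_left mult_ac del: sum.lessThan_Suc)
    then have "(\<Sum>r<m. C r * b ^ r) div b = (\<Sum>r<l. C (Suc r) * b ^ r)"
      using Suc.prems[of 0] m assms(2) by simp
    then have "digit (\<Sum>r<m. C r * b ^ r) b (Suc k) = digit (\<Sum>r<l. C (Suc r) * b ^ r) b k"
      by (simp add: digit_def div_mult2_eq)
    also have "\<dots> = (if k < l then C (Suc k) else 0)"
      using Suc.prems m by (intro Suc.IH) simp
    finally show ?thesis using m by simp
  qed (simp add: digit_def)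
qed

lemma sum_fun_upd:
  fixes C :: "nat \<Rightarrow> nat"
  assumes "i < m"
  shows "(\<Sum>r<m. (C(i := v)) r * b ^ r) + C i * b ^ i = (\<Sum>r<m. C r * b ^ r) + v * b ^ i"
proof -
  have *: "(\<Sum>r<m. D r * b ^ r) = D i * b ^ i + (\<Sum>r\<in>{..<m} - {i}. D r * b ^ r)" for D :: "nat \<Rightarrow> nat"
    using assms by (simp add: sum.remove)
  have "(\<Sum>r\<in>{..<m} - {i}. (C(i := v)) r * b ^ r) = (\<Sum>r\<in>{..<m} - {i}. C r * b ^ r)"
    by (rule sum.cong) auto
  then show ?thesis unfolding *[of C] *[of "C(i := v)"] by simp
qed

definition config_digits :: "nat \<times> (nat \<Rightarrow> nat) \<Rightarrow> nat \<Rightarrow> nat" where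
  "config_digits c r = (case r of 0 \<Rightarrow> fst c | Suc i \<Rightarrow> snd c i)"

definition config_code :: "nat \<Rightarrow> nat \<Rightarrow> nat \<times> (nat \<Rightarrow> nat) \<Rightarrow> nat" where
  "config_code m b c = (\<Sum>r<m. config_digits c r * b ^ r)"

fun ins_digits :: "ins \<Rightarrow> nat list" where
  "ins_digits (Inc i q) = [1, i, q, 0]"
| "ins_digits (Cpy i j q) = [2, i, j, q]"
| "ins_digits (Dec i q q') = [3, i, q, q']"

definition program_code :: "nat \<Rightarrow> ins list \<Rightarrow> nat" where
  "program_code e P = (\<Sum>r<4 * length P. (ins_digits (P ! (r div 4)) ! (r mod 4)) * e ^ r)"

text \<open>One step on codes, for a program in base \<open>e\<close> and a configuration in base \<open>b\<close>: digit \<open>0\<close> of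
  the configuration is the program counter, digit \<open>Suc i\<close> is register \<open>i\<close>, and each instruction
  takes four digits, whose first is the operation code (\<open>0\<close> beyond the end of the program).\<close>

definition code_step :: "nat \<Rightarrow> nat \<Rightarrow> nat \<Rightarrow> nat \<Rightarrow> nat" where
  "code_step z b p e =
    (if digit p e (4 * digit z b 0) = 0 then z
     else if digit p e (4 * digit z b 0) = 1 then
       z + b ^ Suc (digit p e (4 * digit z b 0 + 1)) + digit p e (4 * digit z b 0 + 2) - digit z b 0
     else if digit p e (4 * digit z b 0) = 2 then
       z + digit p e (4 * digit z b 0 + 3)
         + digit z b (Suc (digit p e (4 * digit z b 0 + 1))) * b ^ Suc (digit p e (4 * digit z b 0 + 2))
         - (digit z b 0 + digit z b (Suc (digit p e (4 * digit z b 0 + 2))) * b ^ Suc (digit p e (4 * digit z b 0 + 2)))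
     else if digit z b (Suc (digit p e (4 * digit z b 0 + 1))) = 0 then
       z + digit p e (4 * digit z b 0 + 2) - digit z b 0
     else z + digit p e (4 * digit z b 0 + 3) - (digit z b 0 + b ^ Suc (digit p e (4 * digit z b 0 + 1))))"

lemma recursive_code_step [recursive_intros]:
  "recursive n X \<Longrightarrow> recursive n Y \<Longrightarrow> recursive n Z \<Longrightarrow> recursive n W \<Longrightarrow>
    recursive n (\<lambda>xs. code_step (X xs) (Y xs) (Z xs) (W xs))"
  unfolding code_step_def by (intro recursive_intros)

lemma digit_program_code:
  assumes P: "\<forall>I\<in>set P. ins_bound K I" and e: "K < e" "3 < e" and j: "j < 4"
  shows "digit (program_code e P) e (4 * q + j) = (if q < length P then ins_digits (P ! q) ! j else 0)"
proof -
  have "ins_digits (P ! (r div 4)) ! (r mod 4) < e" if "r < 4 * length P" for r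
  proof -
    have "ins_bound K (P ! (r div 4))" using P that by (simp add: less_mult_imp_div_less mult.commute)
    moreover have "r mod 4 < 4" by simp
    then have "r mod 4 = 0 \<or> r mod 4 = 1 \<or> r mod 4 = 2 \<or> r mod 4 = 3" by linarith
    ultimately show ?thesis using e by (cases "P ! (r div 4)") (auto simp: numeral_3_eq_3)
  qed
  then have "digit (program_code e P) e (4 * q + j) = (if 4 * q + j < 4 * length P
      then ins_digits (P ! ((4 * q + j) div 4)) ! ((4 * q + j) mod 4) else 0)"
    unfolding program_code_def using e by (intro digit_sum) auto
  moreover have "(4 * q + j) div 4 = q" "(4 * q + j) mod 4 = j" using j by auto
  moreover have "4 * q + j < 4 * length P \<longleftrightarrow> q < length P" using j by linarith
  ultimately show ?thesis by simp
qed

lemma digit_config_code: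
  assumes "fst c < b" "\<And>i. snd c i < b"
  shows "digit (config_code m b c) b k = (if k < m then config_digits c k else 0)"
  unfolding config_code_def
  by (rule digit_sum) (use assms in \<open>auto simp: config_digits_def split: nat.split\<close>)

text \<open>The balance is written with sums only, to keep truncated subtraction out. In the same
  spirit \<open>code_step\<close> subtracts only after all additions.\<close>

lemma config_code_update:
  assumes "i + 1 < m"
  shows "config_code m b (q', R(i := v)) + q + R i * b ^ Suc i = config_code m b (q, R) + q' + v * b ^ Suc i"
proof -
  have "config_digits (q', R(i := v)) = (config_digits (q, R))(0 := q', Suc i := v)"
    by (auto simp: config_digits_def fun_eq_iff split: nat.split)
  then show ?thesis
    using sum_fun_upd[of "Suc i" m "(config_digits (q, R))(0 := q')" v b]
      sum_fun_upd[of 0 m "config_digits (q, R)" q' b] assms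
    by (simp add: config_code_def) (simp add: config_digits_def)
qed

lemma code_step:
  assumes P: "\<forall>I\<in>set P. ins_bound K I" and e: "K < e" "3 < e"
    and b: "q < b" "\<And>i. R i < b"
  shows "code_step (config_code (K + 2) b (q, R)) b (program_code e P) e
    = config_code (K + 2) b (step P (q, R))"
proof -
  define z where "z = config_code (K + 2) b (q, R)"
  define p where "p = program_code e P"
  have z0: "digit z b 0 = q"
    using digit_config_code[of "(q, R)"] b by (simp add: config_digits_def z_def)
  have z: "digit z b (Suc i) = R i" if "i \<le> K" for i
    using digit_config_code[of "(q, R)"] b that by (simp add: config_digits_def z_def)
  note p = digit_program_code[OF P e, of _ q, folded p_def]
  note up = config_code_update[where m = "K + 2" and R = R, of _ b _ _ q, folded z_def]
  have "code_step z b p e = config_code (K + 2) b (step P (q, R))"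
  proof (cases "q < length P")
    case False
    then have "digit p e (4 * q) = 0" using p[of 0] by simp
    then show ?thesis using False unfolding code_step_def z0 by (simp add: z_def)
  next
    case q: True
    then have bnd: "ins_bound K (P ! q)" using P by simp
    have d: "digit p e (4 * q) = ins_digits (P ! q) ! 0"
      "\<And>j. j < 4 \<Longrightarrow> digit p e (4 * q + j) = ins_digits (P ! q) ! j"
      using p[of 0] p q by simp_all
    have d': "digit p e (4 * q + 1) = ins_digits (P ! q) ! 1"
      "digit p e (4 * q + 2) = ins_digits (P ! q) ! 2"
      "digit p e (4 * q + 3) = ins_digits (P ! q) ! 3"
      by (rule d(2), simp)+
    show ?thesis
    proof (cases "P ! q")
      case (Inc i q')
      then show ?thesis using up[of i q' "Suc (R i)"] bnd q
        unfolding code_step_def z0 d(1) d' by simp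
    next
      case (Cpy i j q')
      then show ?thesis using up[of j q' "R i"] bnd q
        unfolding code_step_def z0 d(1) d' by (simp add: z)
    next
      case (Dec i q' q'')
      \<comment> \<open>In the zero branch only the control state changes; this is an update of
        register \<open>0\<close> by its own value.\<close>
      then show ?thesis using up[of 0 q' "R 0"] up[of i q'' "R i - 1"] bnd q
        unfolding code_step_def z0 d(1) d' by (cases "R i") (simp_all add: z)
    qed
  qed
  then show ?thesis by (simp only: z_def p_def)
qed

definition input :: "nat \<Rightarrow> nat \<Rightarrow> nat \<Rightarrow> nat" where
  "input x y = (\<lambda>_. 0)(1 := x, 2 := y)"

text \<open>The start value is the code of control state 0 with \<open>p\<close> and
  \<open>e\<close> in registers \<open>1\<close> and \<open>2\<close>, which are the digits 2 and 3.
  A program is thus run on its own code and base.\<close>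

definition run_code :: "nat \<Rightarrow> nat \<Rightarrow> nat \<Rightarrow> nat \<Rightarrow> nat" where
  "run_code n b p e = ((\<lambda>z. code_step z b p e) ^^ n) (p * b\<^sup>2 + e * b ^ 3)"

lemma recursive_run_code [recursive_intros]:
  assumes "recursive n X" "recursive n Y" "recursive n Z" "recursive n W"
  shows "recursive n (\<lambda>xs. run_code (X xs) (Y xs) (Z xs) (W xs))"
proof (rule recursive_op4[where h = run_code, OF _ assms])
  have F: "recursive 3 (\<lambda>xs. xs ! 1 * (xs ! 0)\<^sup>2 + xs ! 2 * (xs ! 0) ^ 3)"
    by (intro recursive_intros) simp_all
  have G: "recursive (Suc (Suc 3)) (\<lambda>xs. code_step (xs ! 1) (xs ! 2) (xs ! 3) (xs ! 4))"
    by (intro recursive_intros) simp_all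
  have "recursive (Suc 3) (\<lambda>xs. (\<lambda>k ys. run_code k (ys ! 0) (ys ! 1) (ys ! 2)) (xs ! 0) (tl xs))"
    by (rule recursive_prec[OF F G]) (simp_all add: run_code_def nth_Cons')
  then have "recursive 4 (\<lambda>xs. run_code (xs ! 0) (tl xs ! 0) (tl xs ! 1) (tl xs ! 2))" by simp
  then show "recursive 4 (\<lambda>xs. run_code (xs ! 0) (xs ! 1) (xs ! 2) (xs ! 3))"
    by (rule recursive_cong) (simp add: nth_tl numeral_2_eq_2 numeral_3_eq_3)
qed

lemma config_code_input:
  assumes "2 \<le> K"
  shows "config_code (K + 2) b (0, input x y) = x * b\<^sup>2 + y * b ^ 3"
proof -
  have "config_code (K + 2) b (0, \<lambda>_. 0) = 0"
    unfolding config_code_def by (intro sum.neutral) (auto simp: config_digits_def split: nat.split)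
  then show ?thesis
    using config_code_update[of 1 "K + 2" b 0 "\<lambda>_. 0" x 0]
      config_code_update[of 2 "K + 2" b 0 "(\<lambda>_. 0)(1 := x)" y 0] assms
    by (simp add: input_def eval_nat_numeral del: fun_upd_apply) simp
qed

text \<open>An increment raises the maximum of the registers by at most one and a copy does not
  raise it, so registers grow at most linearly in time.\<close>

lemma step_bounds:
  assumes "\<forall>I\<in>set P. ins_bound K I" "fst c \<le> K" "\<And>i. snd c i \<le> m"
  shows "fst (step P c) \<le> K" "snd (step P c) i \<le> Suc m"
proof -
  obtain q R where c: "c = (q, R)" by fastforce
  have R: "R j \<le> m" for j using assms(3)[of j] c by simp
  have R': "R j \<le> Suc m" "R j - 1 \<le> Suc m" for j using R[of j] by simp_all
  show "fst (step P c) \<le> K" "snd (step P c) i \<le> Suc m"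
  proof -
    have "fst (step P c) \<le> K \<and> snd (step P c) i \<le> Suc m"
    proof (cases "q < length P")
      case True
      then have "ins_bound K (P ! q)" using assms(1) by simp
      then show ?thesis using True R R' c by (cases "P ! q") auto
    qed (use c assms(2) R' in auto)
    then show "fst (step P c) \<le> K" "snd (step P c) i \<le> Suc m" by simp_all
  qed
qed

lemma run_code:
  assumes P: "\<forall>I\<in>set P. ins_bound K I" and e: "K < e" "3 < e" and K: "2 \<le> K"
    and p: "p = program_code e P" and b: "p + e + t < b"
  shows "run_code t b p e = config_code (K + 2) b ((step P ^^ t) (0, input p e))"
    "fst ((step P ^^ t) (0, input p e)) \<le> K" "snd ((step P ^^ t) (0, input p e)) i \<le> p + e + t"
proof -
  have "run_code t b p e = config_code (K + 2) b ((step P ^^ t) (0, input p e)) \<and>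
    fst ((step P ^^ t) (0, input p e)) \<le> K \<and> (\<forall>i. snd ((step P ^^ t) (0, input p e)) i \<le> p + e + t)"
    using b
  proof (induction t)
    case 0
    have "run_code 0 b p e = config_code (K + 2) b ((step P ^^ 0) (0, input p e))"
      unfolding run_code_def funpow.simps id_apply config_code_input[OF K] ..
    moreover have "fst ((step P ^^ 0) (0, input p e)) \<le> K"
      "\<forall>i. snd ((step P ^^ 0) (0, input p e)) i \<le> p + e + 0"
      by (simp_all add: input_def)
    ultimately show ?case by blast
  next
    case (Suc t)
    obtain q R where c: "(step P ^^ t) (0, input p e) = (q, R)" by fastforce
    have q: "q \<le> K" and R: "\<And>i. R i \<le> p + e + t" and run: "run_code t b p e = config_code (K + 2) b (q, R)"
      using Suc c by auto
    have "code_step (config_code (K + 2) b (q, R)) b p e = config_code (K + 2) b (step P (q, R))"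
      unfolding p
    proof (rule code_step[OF P e])
      show "q < b" using q e Suc.prems by simp
      show "R i < b" for i using R[of i] Suc.prems by simp
    qed
    moreover have "run_code (Suc t) b p e = code_step (run_code t b p e) b p e"
      by (simp add: run_code_def)
    ultimately show ?case
      using step_bounds[OF P, of "(q, R)" "p + e + t"] q R run c by (simp del: step.simps)
  qed
  then show "run_code t b p e = config_code (K + 2) b ((step P ^^ t) (0, input p e))"
    "fst ((step P ^^ t) (0, input p e)) \<le> K" "snd ((step P ^^ t) (0, input p e)) i \<le> p + e + t" by simp_all
qed

lemma funpow_step_halted:
  assumes "length P \<le> fst c" shows "(step P ^^ n) c = c"
proof -
  have "step P c = c" using assms by (cases c) simp
  then show ?thesis by (induction n) simp_all
qed

text \<open>\<open>U\<close> searches for the least \<open>n\<close> such that the program halts within \<open>n\<close> steps. In \<open>n\<close> steps the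
  entries of a configuration stay below \<open>p + e + n + 2\<close>, so with this number as base the simulation of
  \<open>n\<close> steps is free of carries.\<close>

theorem ex_universal:
  "\<exists>U. \<forall>P K e k q R. (\<forall>I\<in>set P. ins_bound K I) \<longrightarrow> 3 \<le> K \<longrightarrow> K < e \<longrightarrow>
     (step P ^^ k) (0, input (program_code e P) e) = (q, R) \<longrightarrow> length P \<le> q \<longrightarrow>
     rec_eval U [program_code e P, e] (R 3)"
proof -
  let ?b = "\<lambda>n p e. p + e + n + 2"
  have "recursive 3 (\<lambda>xs. digit (xs ! 1) (xs ! 2)
      (4 * digit (run_code (xs ! 0) (?b (xs ! 0) (xs ! 1) (xs ! 2)) (xs ! 1) (xs ! 2)) (?b (xs ! 0) (xs ! 1) (xs ! 2)) 0))"
    by (intro recursive_intros) simp_all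
  then obtain f where "\<forall>xs. length xs = 3 \<longrightarrow> rec_eval f xs (digit (xs ! 1) (xs ! 2)
      (4 * digit (run_code (xs ! 0) (?b (xs ! 0) (xs ! 1) (xs ! 2)) (xs ! 1) (xs ! 2)) (?b (xs ! 0) (xs ! 1) (xs ! 2)) 0))"
    unfolding recursive_def by blast
  then have f: "rec_eval f [n, p, e]
      (digit p e (4 * digit (run_code n (?b n p e) p e) (?b n p e) 0))" for n p e
    by (auto dest!: spec[of _ "[n, p, e]"])
  \<comment> \<open>Digit 4 is register \<open>3\<close>, which holds the output.\<close>
  have "recursive 3 (\<lambda>xs. digit
      (run_code (xs ! 0) (?b (xs ! 0) (xs ! 1) (xs ! 2)) (xs ! 1) (xs ! 2)) (?b (xs ! 0) (xs ! 1) (xs ! 2)) 4)"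
    by (intro recursive_intros) simp_all
  then obtain g where "\<forall>xs. length xs = 3 \<longrightarrow> rec_eval g xs (digit
      (run_code (xs ! 0) (?b (xs ! 0) (xs ! 1) (xs ! 2)) (xs ! 1) (xs ! 2)) (?b (xs ! 0) (xs ! 1) (xs ! 2)) 4)"
    unfolding recursive_def by blast
  then have g: "rec_eval g [n, p, e] (digit (run_code n (?b n p e) p e) (?b n p e) 4)" for n p e
    by (auto dest!: spec[of _ "[n, p, e]"])
  show ?thesis
  proof (intro exI[of _ "Comp g [Mini f, Proj 0, Proj 1]"] allI impI)
    fix P K e k q R
    assume P: "\<forall>I\<in>set P. ins_bound K I" and K: "3 \<le> K" "K < e"
      and k: "(step P ^^ k) (0, input (program_code e P) e) = (q, R)" "length P \<le> q"
    define p where "p = program_code e P"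
    define c where "c n = (step P ^^ n) (0, input p e)" for n
    have K': "2 \<le> K" "3 < e" using K by simp_all
    have run: "run_code n (?b n p e) p e = config_code (K + 2) (?b n p e) (c n)" for n
      unfolding c_def by (rule run_code(1)[OF P K(2) K'(2) K'(1) p_def]) simp
    have dig: "digit (run_code n (?b n p e) p e) (?b n p e) r = config_digits (c n) r" if "r < K + 2" for n r
      unfolding run
    proof (subst digit_config_code)
      have bnd: "fst (c n) \<le> K" "\<And>i. snd (c n) i \<le> p + e + n"
        using run_code(2,3)[OF P K(2) K'(2) K'(1) p_def, of n "?b n p e"] unfolding c_def by simp_all
      show "fst (c n) < ?b n p e" using bnd(1) K by simp
      show "snd (c n) i < ?b n p e" for i using bnd(2)[of i] by simp
    qed (use that in simp)
    \<comment> \<open>Operation codes are nonzero, so the function computed by \<open>f\<close>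
      vanishes exactly on halted configurations and \<open>Mini f\<close> finds the halting
      time.\<close>
    have ins0: "ins_digits I ! 0 \<noteq> 0" for I by (cases I) auto
    have test: "rec_eval f [n, p, e] (if fst (c n) < length P then ins_digits (P ! fst (c n)) ! 0 else 0)" for n
    proof -
      have "digit (run_code n (?b n p e) p e) (?b n p e) 0 = fst (c n)"
        by (subst dig) (simp_all add: config_digits_def)
      moreover have "digit p e (4 * fst (c n)) = (if fst (c n) < length P then ins_digits (P ! fst (c n)) ! 0 else 0)"
        using digit_program_code[OF P K(2) K'(2), of 0 "fst (c n)"] by (simp add: p_def)
      ultimately show ?thesis using f[of n p e] by (simp only:)
    qed
    define n where "n = (LEAST n. length P \<le> fst (c n))"
    have halted: "length P \<le> fst (c n)"
      unfolding n_def by (rule LeastI[of _ k]) (use k in \<open>simp add: c_def p_def\<close>)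
    have "n \<le> k" unfolding n_def by (rule Least_le) (use k in \<open>simp add: c_def p_def\<close>)
    \<comment> \<open>The given time \<open>k\<close> need not be the least one, but a halted
      configuration no longer changes, so the output is the same.\<close>
    have "c k = (step P ^^ (k - n)) (c n)"
      unfolding c_def using \<open>n \<le> k\<close> by (simp add: funpow_add[symmetric, THEN fun_cong, unfolded comp_apply])
    then have "c k = c n" using funpow_step_halted[OF halted] by simp
    have "rec_eval (Mini f) [p, e] n"
    proof (rule rec_eval.mini)
      show "rec_eval f [n, p, e] 0" using test[of n] halted by simp
      show "\<forall>i<n. \<exists>y. rec_eval f [i, p, e] (Suc y)"
      proof (intro allI impI)
        fix i assume "i < n"
        then have "fst (c i) < length P" unfolding n_def using not_less_Least by fastforce
        then show "\<exists>y. rec_eval f [i, p, e] (Suc y)" using test[of i] ins0[of "P ! fst (c i)"]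
          by (metis not0_implies_Suc)
      qed
    qed
    moreover have "rec_eval (Proj 0) [p, e] p" "rec_eval (Proj 1) [p, e] e"
      using rec_eval.proj[of 0 "[p, e]"] rec_eval.proj[of 1 "[p, e]"] by simp_all
    moreover have "rec_eval g [n, p, e] (R 3)"
    proof -
      have "digit (run_code n (?b n p e) p e) (?b n p e) 4 = R 3"
        using dig[of 4 n] K k(1) \<open>c k = c n\<close>[symmetric]
        by (simp add: config_digits_def c_def p_def eval_nat_numeral)
      then show ?thesis using g[of n p e] by simp
    qed
    ultimately show "rec_eval (Comp g [Mini f, Proj 0, Proj 1]) [program_code e P, e] (R 3)"
      unfolding p_def by (intro rec_eval.comp[where ys = "[n, program_code e P, e]"]) simp_all
  qed
qed

section \<open>Words over the states of an automaton\<close>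

primrec wact :: "('a, 's) mealy \<Rightarrow> 'a list \<Rightarrow> 's list \<Rightarrow> 's list" where
  "wact M [] z = z"
| "wact M (p # ps) z = act M p (wact M ps z)"

primrec wsigma :: "('a, 's) mealy \<Rightarrow> 'a list \<Rightarrow> 's \<Rightarrow> 's" where
  "wsigma M [] x = x"
| "wsigma M (p # ps) x = sigma M p (wsigma M ps x)"

text \<open>This is the section of a word at a letter, again as a word. The last letter of a word
  acts first, as in a composition of maps.\<close>

primrec wdelta :: "('a, 's) mealy \<Rightarrow> 'a list \<Rightarrow> 's \<Rightarrow> 'a list" where
  "wdelta M [] x = []"
| "wdelta M (p # ps) x = delta M p (wsigma M ps x) # wdelta M ps x"

lemma wact_append [simp]: "wact M (u @ v) z = wact M u (wact M v z)"
  by (induction u) auto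

lemma wsigma_append [simp]: "wsigma M (u @ v) x = wsigma M u (wsigma M v x)"
  by (induction u) auto

lemma wdelta_append [simp]: "wdelta M (u @ v) x = wdelta M u (wsigma M v x) @ wdelta M v x"
  by (induction u) auto

lemma wact_Nil [simp]: "wact M u [] = []"
  by (induction u) auto

lemma wact_Cons: "wact M u (x # z) = wsigma M u x # wact M (wdelta M u x) z"
  by (induction u) auto

text \<open>The power of \<open>w\<close> with exponent \<open>2 ^ k\<close>. The squaring happens
  inside, so that the sections of \<open>w @ w\<close> can be taken before the remaining powers are
  formed.\<close>

primrec pow2 :: "'a list \<Rightarrow> nat \<Rightarrow> 'a list" where
  "pow2 w 0 = w"
| "pow2 w (Suc k) = pow2 (w @ w) k"

lemma pow2_Suc': "pow2 w (Suc k) = pow2 w k @ pow2 w k"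
proof (induction k arbitrary: w)
  case (Suc k)
  show ?case
    by (subst pow2.simps(2)) (simp only: Suc.IH pow2.simps(2)[symmetric])
qed simp

lemma pow2_section:
  assumes "wsigma M w x = x"
  shows "wsigma M (pow2 w k) x = x \<and> wdelta M (pow2 w k) x = pow2 (wdelta M w x) k"
  using assms by (induction k arbitrary: w) auto

lemma pow2_commute: "pow2 w k @ w = w @ pow2 w k"
proof -
  have "\<exists>n. pow2 w k = concat (replicate n w)"
  proof (induction k)
    case 0 show ?case by (rule exI[of _ 1]) simp
  next
    case (Suc k)
    then obtain n where "pow2 w k = concat (replicate n w)" by blast
    then have "pow2 w (Suc k) = concat (replicate (n + n) w)"
      by (simp add: pow2_Suc' replicate_add del: pow2.simps)
    then show ?case by blast
  qed
  then obtain n where n: "pow2 w k = concat (replicate n w)" by blast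
  have "concat (replicate n w) @ w = w @ concat (replicate n w)"
    by (induction n) auto
  with n show ?thesis by simp
qed

lemma pow2_trivial:
  assumes "\<And>z. wact M w z = z" shows "wact M (pow2 w k) z = z"
  by (induction k arbitrary: z) (auto simp: pow2_Suc' assms simp del: pow2.simps(2))

text \<open>\<open>Ctl q\<close> and \<open>Piv\<close> are the involutions \<open>s\<^sub>q\<close> and \<open>t\<close>, and \<open>Up i\<close>, \<open>Dn i\<close> are the letter \<open>a\<^sub>i\<close> and its
  inverse. \<open>Lift p\<close> acts as \<open>p\<close> below \<open>Lft\<close>, and \<open>Swap\<close> exchanges \<open>Lft\<close> and \<open>Rgt\<close>. The four
  letters \<open>Pt q c b\<close> serve instruction \<open>q\<close>: \<open>Piv\<close> toggles \<open>c\<close>, and \<open>b\<close> records a parity when \<open>c\<close>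
  is false.\<close>

datatype state = Eps | Ctl nat | Piv | Up nat | Dn nat | Lift state | Swap
datatype letter = Lft | Rgt | Pt nat bool bool

instance state :: countable by countable_datatype
instance letter :: countable by countable_datatype

primrec sinv :: "state \<Rightarrow> state" where
  "sinv Eps = Eps"
| "sinv (Ctl q) = Ctl q"
| "sinv Piv = Piv"
| "sinv (Up i) = Dn i"
| "sinv (Dn i) = Up i"
| "sinv (Lift p) = Lift (sinv p)"
| "sinv Swap = Swap"

lemma sinv_sinv [simp]: "sinv (sinv p) = p"
  by (induction p) auto

definition tests :: "ins list \<Rightarrow> nat \<Rightarrow> nat \<Rightarrow> bool" where
  "tests P q i \<longleftrightarrow> q < length P \<and> (\<exists>q' q''. P ! q = Dec i q' q'')"

text \<open>With \<open>c\<close> true this gives the section \<open>u1\<close> of the conjugating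
  word, with \<open>c\<close> false the section \<open>u2\<close>; the successor uses the inverse of
  \<open>u1\<close> followed by \<open>u2\<close>. For \<open>Inc j\<close>, both parts contribute
  every \<open>Up j\<close>, which doubles their number. For \<open>Cpy j k\<close>, the old
  \<open>Up k\<close> are erased in \<open>u2\<close>, and \<open>u1\<close> supplies one for each
  \<open>Up j\<close>. For \<open>Dec j\<close>, \<open>u1\<close> is erased, and \<open>b\<close>,
  toggled by every \<open>Up j\<close>, lets every second one survive in \<open>u2\<close>.\<close>

definition up_section :: "ins list \<Rightarrow> nat \<Rightarrow> bool \<Rightarrow> bool \<Rightarrow> nat \<Rightarrow> state" where
  "up_section P q c b i = (if q < length P then
     (case P ! q of
        Inc j q' \<Rightarrow> (if c then (if i = j then Dn i else Eps) else Up i)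
      | Cpy j k q' \<Rightarrow> (if c then (if i = j then Dn k else Eps) else (if i = k then Eps else Up i))
      | Dec j q' q'' \<Rightarrow> (if c \<or> i = j \<and> \<not> b then Eps else Up i))
     else Eps)"

fun ctl_section :: "ins \<Rightarrow> bool \<Rightarrow> bool \<Rightarrow> state" where
  "ctl_section I True b = (if b then Eps else Piv)"
| "ctl_section (Inc i q') False b = (if b then Eps else Ctl q')"
| "ctl_section (Cpy i j q') False b = (if b then Eps else Ctl q')"
| "ctl_section (Dec i q' q'') False b = Ctl (if b then q' else q'')"

fun out_letter :: "ins list \<Rightarrow> state \<Rightarrow> letter \<Rightarrow> letter" where
  "out_letter P (Up i) (Pt q c b) = Pt q c (b \<noteq> (\<not> c \<and> tests P q i))"
| "out_letter P (Dn i) (Pt q c b) = Pt q c (b \<noteq> (\<not> c \<and> tests P q i))"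
| "out_letter P Piv (Pt q c b) = Pt q (\<not> c) b"
| "out_letter P Swap Lft = Rgt"
| "out_letter P Swap Rgt = Lft"
| "out_letter P p x = x"

text \<open>The section of an inverse at a letter is the inverse of the section at the preimage of
  that letter; this explains the changed parity bit in the clause for \<open>Dn\<close>.
  \<open>Ctl k\<close> acts only below the letters of its own instruction.\<close>

fun next_state :: "ins list \<Rightarrow> state \<Rightarrow> letter \<Rightarrow> state" where
  "next_state P (Up i) (Pt q c b) = up_section P q c b i"
| "next_state P (Dn i) (Pt q c b) = sinv (up_section P q c (b \<noteq> (\<not> c \<and> tests P q i)) i)"
| "next_state P (Ctl k) (Pt q c b) = (if q = k \<and> q < length P then ctl_section (P ! q) c b else Eps)"
| "next_state P (Lift p) Lft = p"
| "next_state P p x = Eps"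

lemma out_letter_sinv: "out_letter P (sinv p) (out_letter P p x) = x"
  by (cases p; cases x) auto

lemma sinv_ctl_section [simp]: "sinv (ctl_section I c b) = ctl_section I c b"
  by (cases I; cases c) auto

lemma next_state_sinv: "next_state P (sinv p) (out_letter P p x) = sinv (next_state P p x)"
proof -
  have "((a = b) = b) = a" for a b by auto
  then show ?thesis by (cases p; cases x) auto
qed

definition counter_mealy :: "ins list \<Rightarrow> nat \<Rightarrow> (state, letter) mealy" where
  "counter_mealy P K = (let Q = {Eps, Piv} \<union> Ctl ` {..K} \<union> Up ` {..K} \<union> Dn ` {..K} in
     \<lparr>states = Q \<union> Lift ` Q \<union> {Swap},
      alphabet = {Lft, Rgt} \<union> {Pt q c b | q c b. q < length P},
      delta = next_state P, sigma = out_letter P\<rparr>)"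

lemma counter_mealy_simps [simp]: "delta (counter_mealy P K) = next_state P" "sigma (counter_mealy P K) = out_letter P"
  by (simp_all add: counter_mealy_def Let_def)

definition winv :: "state list \<Rightarrow> state list" where
  "winv u = rev (map sinv u)"

lemma winv_simps [simp]: "winv [] = []" "winv (p # u) = winv u @ [sinv p]"
  "winv (u @ v) = winv v @ winv u" "winv (winv u) = u"
  by (simp_all add: winv_def rev_map comp_def)

lemma act_sinv [simp]: "act (counter_mealy P K) (sinv p) (act (counter_mealy P K) p z) = z"
  by (induction z arbitrary: p) (auto simp: out_letter_sinv next_state_sinv)

lemma act_sinv' [simp]: "act (counter_mealy P K) p (act (counter_mealy P K) (sinv p) z) = z"
  using act_sinv[of P K "sinv p" z] by simp

lemma wact_winv [simp]: "wact (counter_mealy P K) (winv u) (wact (counter_mealy P K) u z) = z"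
  by (induction u arbitrary: z) (auto)

lemma wact_winv' [simp]: "wact (counter_mealy P K) u (wact (counter_mealy P K) (winv u) z) = z"
  using wact_winv[of P K "winv u" z] by simp

lemma wsigma_winv: "wsigma (counter_mealy P K) (winv u) (wsigma (counter_mealy P K) u x) = x"
  by (induction u arbitrary: x) (auto simp: out_letter_sinv)

lemma wdelta_winv: "wdelta (counter_mealy P K) (winv u) (wsigma (counter_mealy P K) u x) = winv (wdelta (counter_mealy P K) u x)"
  by (induction u arbitrary: x) (auto simp: out_letter_sinv next_state_sinv)

lemma act_Eps [simp]: "act (counter_mealy P K) Eps z = z"
proof (induction z)
  case (Cons x z) then show ?case by (cases x) auto
qed simp

lemma act_self_inverse:
  "sinv p = p \<Longrightarrow> act (counter_mealy P K) p (act (counter_mealy P K) p z) = z"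
  using act_sinv[of P K p z] by simp

text \<open>The inner conjugate is trivial, so the word acts as the involution \<open>p\<close>, and
  its square is already trivial.\<close>

lemma wact_conjugate:
  assumes "sinv p = p"
  shows "wact (counter_mealy P K) (pow2 ([p] @ winv u @ [Eps] @ u) (Suc k)) z = z"
proof -
  have "wact (counter_mealy P K) (([p] @ winv u @ [Eps] @ u) @ ([p] @ winv u @ [Eps] @ u)) z = z" for z
    by (simp add: act_self_inverse[OF assms])
  then show ?thesis unfolding pow2.simps(2) by (rule pow2_trivial)
qed

section \<open>Configurations as words\<close>

definition config_word :: "nat \<Rightarrow> state list \<Rightarrow> state list" where
  "config_word q u = [Ctl q] @ winv u @ [Piv] @ u"

text \<open>Only the number of occurrences of each letter matters, not their order, and erased
  letters stay behind as \<open>Eps\<close>. Register value 0 corresponds to one occurrence.\<close>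

definition encodes :: "nat \<Rightarrow> state list \<Rightarrow> (nat \<Rightarrow> nat) \<Rightarrow> bool" where
  "encodes K u r \<longleftrightarrow> set u \<subseteq> insert Eps (Up ` {..K}) \<and> (\<forall>i\<le>K. count_list u (Up i) = 2 ^ r i)"

lemma wsigma_True:
  assumes "set u \<subseteq> insert Eps (range Up)"
  shows "wsigma (counter_mealy P K) u (Pt q True b) = Pt q True b"
  using assms by (induction u) auto

lemma wsigma_False_test:
  assumes "set u \<subseteq> insert Eps (range Up)" "q < length P" "P ! q = Dec i q' q''"
  shows "wsigma (counter_mealy P K) u (Pt q False b) = Pt q False (b \<noteq> odd (count_list u (Up i)))"
  using assms(1) by (induction u) (auto simp: tests_def assms(2,3))

lemma wsigma_False_no_test:
  assumes "set u \<subseteq> insert Eps (range Up)" "\<And>i. \<not> tests P q i"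
  shows "wsigma (counter_mealy P K) u (Pt q c b) = Pt q c b"
  using assms(1) by (induction u) (auto simp: assms(2))

text \<open>\<open>d\<close> is the parity of the number of tested letters, or false if the
  instruction tests nothing. It does not depend on \<open>b\<close>, so \<open>u\<close> permutes
  the two values of the bit.\<close>

lemma wsigma_False:
  assumes "set u \<subseteq> insert Eps (range Up)"
  obtains d where "\<And>b. wsigma (counter_mealy P K) u (Pt q False b) = Pt q False (b \<noteq> d)"
proof (cases "\<exists>i. tests P q i")
  case True
  then show ?thesis using wsigma_False_test[OF assms] that unfolding tests_def by blast
next
  case False
  then show ?thesis using wsigma_False_no_test[OF assms] that[of False] by simp
qed

text \<open>Follow the letter through \<open>W\<close> from the right. In the first pass
  \<open>u\<close> turns \<open>b\<close> into \<open>b'\<close>, \<open>Piv\<close> makes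
  \<open>c\<close> true, and \<open>winv u\<close> changes nothing. In the second pass
  \<open>u\<close> changes nothing, \<open>Piv\<close> makes \<open>c\<close> false again, and
  \<open>winv u\<close> restores \<open>b\<close>. The sections collected on the way combine to the
  stated word, the \<open>Eps\<close> in \<open>g\<close> being the section of
  \<open>Piv\<close>.\<close>

lemma config_word_section:
  fixes P K u q r b
  defines "M \<equiv> counter_mealy P K" and "W \<equiv> config_word q u"
  assumes u: "set u \<subseteq> insert Eps (range Up)"
    and d: "wsigma M u (Pt r False b) = Pt r False b'"
  defines "g \<equiv> winv (wdelta M u (Pt r True b')) @ [Eps] @ wdelta M u (Pt r False b)"
  shows "wsigma M W (Pt r False b) = Pt r True b'"
    and "wsigma M W (Pt r True b') = Pt r False b"
    and "wdelta M (W @ W) (Pt r False b) =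
      [next_state P (Ctl q) (Pt r False b)] @ winv g @ [next_state P (Ctl q) (Pt r True b')] @ g"
proof -
  have T: "wsigma M u (Pt r True b') = Pt r True b'"
    unfolding M_def by (rule wsigma_True[OF u])
  have T': "wsigma M (winv u) (Pt r True b') = Pt r True b'"
    using wsigma_winv[of P K u "Pt r True b'"] T unfolding M_def by simp
  have F': "wsigma M (winv u) (Pt r False b') = Pt r False b"
    using wsigma_winv[of P K u "Pt r False b"] d unfolding M_def by simp
  have dT: "wdelta M (winv u) (Pt r True b') = winv (wdelta M u (Pt r True b'))"
    using wdelta_winv[of P K u "Pt r True b'"] T unfolding M_def by simp
  have dF: "wdelta M (winv u) (Pt r False b') = winv (wdelta M u (Pt r False b))"
    using wdelta_winv[of P K u "Pt r False b"] d unfolding M_def by simp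
  have M: "sigma M = out_letter P" "delta M = next_state P" unfolding M_def by simp_all
  show 1: "wsigma M W (Pt r False b) = Pt r True b'"
    by (simp add: W_def config_word_def M d T')
  show 2: "wsigma M W (Pt r True b') = Pt r False b"
    by (simp add: W_def config_word_def M F' T)
  show "wdelta M (W @ W) (Pt r False b) =
      [next_state P (Ctl q) (Pt r False b)] @ winv g @ [next_state P (Ctl q) (Pt r True b')] @ g"
    unfolding wdelta_append 1
    by (simp add: W_def config_word_def M d T T' F' dT dF g_def)
qed

lemma count_list_winv: "count_list (winv u) p = count_list u (sinv p)"
proof -
  have "count_list (map sinv u) p = count_list u (sinv p)"
    by (induction u) auto
  then show ?thesis by (simp add: winv_def)
qed

lemma set_winv: "set (winv u) = sinv ` set u"
  by (simp add: winv_def)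

lemma encodes_step:
  fixes P K u q R
  defines "M \<equiv> counter_mealy P K"
  assumes e: "encodes K u R" and q: "q < length P" and bnd: "ins_bound K (P ! q)"
    and st: "step P (q, R) = (q', R')"
  obtains u' b where "encodes K u' R'"
    "wsigma M u (Pt q False b) = Pt q False False"
    "[next_state P (Ctl q) (Pt q False b)] @
       winv (winv (wdelta M u (Pt q True False)) @ [Eps] @ wdelta M u (Pt q False b)) @
       [next_state P (Ctl q) (Pt q True False)] @
       (winv (wdelta M u (Pt q True False)) @ [Eps] @ wdelta M u (Pt q False b))
     = config_word q' u'"
proof -
  have u: "set u \<subseteq> insert Eps (range Up)" and uK: "set u \<subseteq> insert Eps (Up ` {..K})"
    and cnt: "\<And>i. i \<le> K \<Longrightarrow> count_list u (Up i) = 2 ^ R i"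
    using e by (auto simp: encodes_def)
  have M: "sigma M = out_letter P" "delta M = next_state P" unfolding M_def by simp_all
  let ?uT = "wdelta M u (Pt q True False)" and ?uF = "\<lambda>b. wdelta M u (Pt q False b)"
  let ?g = "\<lambda>b. winv ?uT @ [Eps] @ ?uF b"
  note goal = that
  \<comment> \<open>At \<open>Pt q True False\<close> the section of \<open>Ctl q\<close> is
    \<open>Piv\<close> for every instruction, so these three facts suffice.\<close>
  have main: "thesis" if "encodes K (?g b) R'" "wsigma M u (Pt q False b) = Pt q False False"
    "ctl_section (P ! q) False b = Ctl q'" for b
    by (rule goal[of "?g b" b]) (use that q in \<open>simp_all add: config_word_def\<close>)
  show thesis
  proof (cases "P ! q")
    case (Inc j k)
    have nt: "\<And>i. \<not> tests P q i" using Inc by (simp add: tests_def)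
    have s: "wsigma M u (Pt q c b) = Pt q c b" if "set u \<subseteq> insert Eps (range Up)" for c b u
      unfolding M_def using that nt by (rule wsigma_False_no_test)
    have F: "?uF False = u"
      using u by (induction u) (auto simp: M s up_section_def q Inc)
    have T: "?uT = map (\<lambda>p. if p = Up j then Dn j else Eps) u"
      using u by (induction u) (auto simp: M s up_section_def q Inc split: if_splits)
    have "count_list (map (\<lambda>p. if p = Up j then Dn j else Eps) v) (Dn i)
       = (if i = j then count_list v (Up j) else 0)" for v i
      by (induction v) auto
    then have "encodes K (?g False) R'"
      using uK cnt Inc st q bnd unfolding F T encodes_def
      by (auto simp: count_list_winv set_winv split: if_splits)
    then show thesis using s[OF u] Inc st q by (intro main) auto
  next
    case (Cpy j k l)
    have nt: "\<And>i. \<not> tests P q i" using Cpy by (simp add: tests_def)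
    have s: "wsigma M u (Pt q c b) = Pt q c b" if "set u \<subseteq> insert Eps (range Up)" for c b u
      unfolding M_def using that nt by (rule wsigma_False_no_test)
    have F: "?uF False = map (\<lambda>p. if p = Up k then Eps else p) u"
      using u by (induction u) (auto simp: M s up_section_def q Cpy split: if_splits)
    have T: "?uT = map (\<lambda>p. if p = Up j then Dn k else Eps) u"
      using u by (induction u) (auto simp: M s up_section_def q Cpy split: if_splits)
    have "count_list (map (\<lambda>p. if p = Up j then Dn k else Eps) v) (Dn i)
       = (if i = k then count_list v (Up j) else 0)" for v i
      by (induction v) auto
    moreover have "count_list (map (\<lambda>p. if p = Up k then Eps else p) v) (Up i)
       = (if i = k then 0 else count_list v (Up i))" for v i
      by (induction v) auto
    ultimately have "encodes K (?g False) R'"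
      using uK cnt Cpy st q bnd unfolding F T encodes_def
      by (auto simp: count_list_winv set_winv split: if_splits)
    then show thesis using s[OF u] Cpy st q by (intro main) auto
  next
    case (Dec j k l)
    have j: "j \<le> K" using bnd Dec by simp
    have s: "wsigma M u (Pt q True b) = Pt q True b" if "set u \<subseteq> insert Eps (range Up)" for b u
      unfolding M_def using that by (rule wsigma_True)
    have s': "wsigma M u (Pt q False b) = Pt q False (b \<noteq> odd (count_list u (Up j)))"
      if "set u \<subseteq> insert Eps (range Up)" for b u
      unfolding M_def using that q Dec by (rule wsigma_False_test)
    have T: "?uT = map (\<lambda>p. Eps) u"
      using u by (induction u) (auto simp: M s up_section_def q Dec)
    \<comment> \<open>The bit alternates along the occurrences of \<open>Up j\<close>, so half of
      them survive; the initial \<open>b\<close> decides how an odd number is rounded.\<close>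
    have F: "count_list (?uF b) (Up i) =
        (if i = j then (count_list u (Up j) + of_bool b) div 2 else count_list u (Up i))" for b i
      using u
    proof (induction u)
      case (Cons p v)
      then show ?case
        by (cases "even (count_list v (Up j))")
          (auto simp: M s' up_section_def q Dec elim!: evenE oddE)
    qed auto
    have setF: "set (?uF b) \<subseteq> insert Eps (Up ` {..K})" for b
      using uK u
    proof (induction u)
      case (Cons p v)
      then show ?case by (auto simp: M s' up_section_def q Dec split: if_splits)
    qed auto
    have cT: "count_list (map (\<lambda>p. Eps) v) (Dn i) = 0" for v i
      by (induction v) auto
    show thesis
    proof (cases "R j = 0")
      case True
      \<comment> \<open>A zero register is a single letter, which must survive: this requires the
        initial bit to be true. As one is odd, the bit is then false after \<open>u\<close>.\<close>
      have "encodes K (?g True) R'"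
        using cnt True Dec st q bnd setF[of True] unfolding T encodes_def
        by (auto simp: F cT count_list_winv set_winv)
      then show thesis using s'[OF u] Dec st q True cnt[OF j] by (intro main) auto
    next
      case False
      then obtain m where m: "R j = Suc m" by (cases "R j") auto
      have "encodes K (?g False) R'"
        using cnt m Dec st q bnd setF[of False] unfolding T encodes_def
        by (auto simp: F cT count_list_winv set_winv)
      then show thesis using s'[OF u] Dec st q m cnt[OF j] by (intro main) auto
    qed
  qed
qed

text \<open>The path of \<open>Pt q False b\<close> under the word is \<open>Pt q False b\<close>, \<open>Pt q True b'\<close>, \<open>Pt q False b\<close>. The output of
  \<open>Ctl q\<close> at \<open>Pt q True b'\<close> is \<open>Piv\<close> for exactly one \<open>b\<close>, which thereby selects the branch of a test.\<close>

lemma config_word_step: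
  assumes wf: "\<forall>I\<in>set P. ins_bound K I"
    and e: "encodes K u R" and q: "q < length P" and st: "step P (q, R) = (q', R')"
  obtains u' b where "encodes K u' R'"
    "wsigma (counter_mealy P K) u (Pt q False b) = Pt q False False"
    "wdelta (counter_mealy P K) (config_word q u @ config_word q u) (Pt q False b) = config_word q' u'"
proof -
  have bnd: "ins_bound K (P ! q)" using wf q by simp
  have u: "set u \<subseteq> insert Eps (range Up)" using e by (auto simp: encodes_def)
  show thesis
    by (rule encodes_step[OF e q bnd st, of thesis], rule that)
      (auto simp only: config_word_section(3)[OF u])
qed

lemma act_Ctl_halted: "length P \<le> q \<Longrightarrow> act (counter_mealy P K) (Ctl q) z = z"
proof (cases z)
  case (Cons x y)
  assume "length P \<le> q"
  then show ?thesis using Cons by (cases x) auto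
qed simp

lemma next_state_Ctl_self_inverse: "sinv (next_state P (Ctl q) x) = next_state P (Ctl q) x"
  by (cases x) auto

lemma config_word_fixes_Lft_Rgt:
  assumes "set u \<subseteq> insert Eps (range Up)" "x \<in> {Lft, Rgt}"
  shows "wact (counter_mealy P K) (config_word q u) (x # z) = x # z"
proof -
  have 1: "act (counter_mealy P K) p (x # z) = x # z" if "p \<in> {Eps, Piv, Ctl q} \<union> range Up \<union> range Dn" for p
    using assms(2) that by auto
  have "wact (counter_mealy P K) w (x # z) = x # z" if "set w \<subseteq> {Eps, Piv, Ctl q} \<union> range Up \<union> range Dn" for w
    using that
  proof (induction w)
    case (Cons p w) then show ?case using 1[of p] by (simp only: wact.simps) auto
  qed simp
  moreover have "set (config_word q u) \<subseteq> {Eps, Piv, Ctl q} \<union> range Up \<union> range Dn"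
    using assms(1) by (auto simp: config_word_def set_winv)
  ultimately show ?thesis by blast
qed

section \<open>Halting and orders that are powers of two\<close>

lemma Pt_in_alphabet: "Pt q c b \<in> alphabet (counter_mealy P K) \<longleftrightarrow> q < length P"
  by (auto simp: counter_mealy_def Let_def)

text \<open>Induction on the exponent. The word of a running configuration is nontrivial, which
  excludes \<open>k = 0\<close>; otherwise a section of its square is the word of the successor,
  whose order divides half of the given power.\<close>

lemma pow2_order_imp_halts:
  assumes wf: "\<forall>I\<in>set P. ins_bound K I"
    and "encodes K u R"
    and "\<And>z. z \<in> lists (alphabet (counter_mealy P K)) \<Longrightarrow> wact (counter_mealy P K) (pow2 (config_word q u) k) z = z"
  shows "halts P (q, R)"
  using assms(2,3)
proof (induction k arbitrary: q u R)
  case (0 q u R)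
  show ?case
  proof (cases "q < length P")
    case False
    then show ?thesis unfolding halts_def by (intro exI[of _ 0]) simp
  next
    case True
    obtain q' R' where st: "step P (q, R) = (q', R')" by fastforce
    obtain u' b where b: "wsigma (counter_mealy P K) u (Pt q False b) = Pt q False False"
      using config_word_step[OF wf 0(1) True st] by blast
    have u: "set u \<subseteq> insert Eps (range Up)" using 0(1) by (auto simp: encodes_def)
    \<comment> \<open>The word changes \<open>c\<close>, so it does not act trivially.\<close>
    have "wact (counter_mealy P K) (config_word q u) [Pt q False b] = [Pt q True False]"
      using config_word_section(1)[OF u b] by (simp add: wact_Cons)
    moreover have "[Pt q False b] \<in> lists (alphabet (counter_mealy P K))"
      using True by (simp add: Pt_in_alphabet)
    ultimately show ?thesis using 0(2)[of "[Pt q False b]"] by simp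
  qed
next
  case (Suc k q u R)
  show ?case
  proof (cases "q < length P")
    case False
    then show ?thesis unfolding halts_def by (intro exI[of _ 0]) simp
  next
    case True
    let ?M = "counter_mealy P K" and ?W = "config_word q u" and ?x = "\<lambda>b. Pt q False b"
    obtain q' R' where st: "step P (q, R) = (q', R')" by fastforce
    have u: "set u \<subseteq> insert Eps (range Up)" using Suc.prems(1) by (auto simp: encodes_def)
    obtain u' b where e: "encodes K u' R'"
      and b: "wsigma ?M u (?x b) = Pt q False False"
      and W': "wdelta ?M (?W @ ?W) (?x b) = config_word q' u'"
      using config_word_step[OF wf Suc.prems(1) True st] by blast
        have fixed: "wsigma ?M (?W @ ?W) (?x b) = ?x b"
      using config_word_section(1,2)[OF u b] by simp
    have "wact ?M (pow2 (config_word q' u') k) y = y" if "y \<in> lists (alphabet ?M)" for y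
    proof -
      have "?x b # y \<in> lists (alphabet ?M)" using that True by (simp add: Pt_in_alphabet)
      from Suc.prems(2)[OF this] show ?thesis
        using pow2_section[OF fixed, of k] W' by (simp add: wact_Cons del: wsigma_append wdelta_append)
    qed
    from Suc.IH[OF e this] obtain n where "length P \<le> fst ((step P ^^ n) (q', R'))"
      unfolding halts_def by blast
    then show ?thesis unfolding halts_def
      by (intro exI[of _ "Suc n"]) (simp only: funpow_Suc_right comp_apply st)
  qed
qed

text \<open>Induction on the number of steps. Each step back to a predecessor raises the exponent by
  two: once to fix the first level of the tree, once to kill the involutions among the
  sections.\<close>

lemma halts_imp_pow2_order:
  assumes wf: "\<forall>I\<in>set P. ins_bound K I"
    and "encodes K u R" and "length P \<le> fst ((step P ^^ n) (q, R))"
  shows "\<exists>k. \<forall>z. wact (counter_mealy P K) (pow2 (config_word q u) k) z = z"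
  using assms(2,3)
proof (induction n arbitrary: q u R)
  \<comment> \<open>Beyond the end of the program \<open>Ctl q\<close> acts trivially, so the word
    acts as a conjugate of the involution \<open>Piv\<close>.\<close>
  have halted: "\<exists>k. \<forall>z. wact (counter_mealy P K) (pow2 (config_word q u) k) z = z"
    if "length P \<le> q" for q u
  proof -
    have "wact (counter_mealy P K) (config_word q u @ config_word q u) z = z" for z
      using that by (simp add: config_word_def act_Ctl_halted act_self_inverse)
    then show ?thesis by (intro exI[of _ 1]) simp
  qed
  {
    case (0 q u R)
    then show ?case using halted by simp
  next
    case (Suc n q u R)
    let ?M = "counter_mealy P K" and ?W = "config_word q u"
    show ?case
    proof (cases "q < length P")
      case False
      then show ?thesis using halted by simp
    next
      case True
      obtain q' R' where st: "step P (q, R) = (q', R')" by fastforce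
      have u: "set u \<subseteq> insert Eps (range Up)" using Suc.prems(1) by (auto simp: encodes_def)
      obtain u' b where e: "encodes K u' R'"
        and b: "wsigma ?M u (Pt q False b) = Pt q False False"
        and W': "wdelta ?M (?W @ ?W) (Pt q False b) = config_word q' u'"
        using config_word_step[OF wf Suc.prems(1) True st] by blast
      have "length P \<le> fst ((step P ^^ n) (q', R'))"
        using Suc.prems(2) by (simp only: funpow_Suc_right comp_apply st)
      from Suc.IH[OF e this] obtain k where
        k: "\<And>z. wact ?M (pow2 (config_word q' u') k) z = z" by blast
      \<comment> \<open>The successor needs only exponent \<open>k\<close>, but the other sections
        are involutions or trivial and may need one more squaring; hence
        \<open>Suc k\<close>.\<close>
      let ?V = "pow2 (?W @ ?W) (Suc k)"
      have F: "wact ?M ?V (Pt r False c # y) = Pt r False c # y" for r c y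
      proof -
        obtain c' where c': "wsigma ?M u (Pt r False c) = Pt r False c'"
          using wsigma_False[OF u] by blast
        have fixed: "wsigma ?M (?W @ ?W) (Pt r False c) = Pt r False c"
          using config_word_section(1,2)[OF u c'] by simp
        have "wact ?M (pow2 (wdelta ?M (?W @ ?W) (Pt r False c)) (Suc k)) y = y"
        proof (cases "r = q \<and> \<not> c'")
          case True
          obtain d where "\<And>b. wsigma ?M u (Pt r False b) = Pt r False (b \<noteq> d)"
            using wsigma_False[OF u] by blast
          \<comment> \<open>Both bits are sent to false by \<open>u\<close>, which permutes the two
            values.\<close>
          then have "c = b" using c' b True by auto
          then have "wdelta ?M (?W @ ?W) (Pt r False c) = config_word q' u'" using W' True by simp
          then show ?thesis by (simp only: pow2_Suc' wact_append k)
        next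
          case False
          then have out: "next_state P (Ctl q) (Pt r True c') = Eps" by auto
          show ?thesis unfolding config_word_section(3)[OF u c'] out
            by (rule wact_conjugate[OF next_state_Ctl_self_inverse])
        qed
        then show ?thesis
          using pow2_section[OF fixed, of "Suc k"] by (simp add: wact_Cons del: wsigma_append wdelta_append pow2.simps)
      qed
      \<comment> \<open>\<open>?W\<close> carries a letter with \<open>c\<close> false to the given
        one. It commutes with its power \<open>?V\<close>, so the trivial action of
        \<open>?V\<close> is carried over as well.\<close>
      have T: "wact ?M ?V (Pt r True c # y) = Pt r True c # y" for r c y
      proof -
        obtain d where d: "\<And>b. wsigma ?M u (Pt r False b) = Pt r False (b \<noteq> d)"
          using wsigma_False[OF u] by blast
        have c: "wsigma ?M u (Pt r False (c \<noteq> d)) = Pt r False c" using d by auto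
        let ?x = "Pt r False (c \<noteq> d)"
        let ?y = "wact ?M (winv (wdelta ?M ?W ?x)) y"
        have W: "wact ?M ?W (?x # ?y) = Pt r True c # y"
          using config_word_section(1)[OF u c] by (simp add: wact_Cons)
        have "wact ?M (?V @ ?W) z = wact ?M (?W @ ?V) z" for z
          using pow2_commute[of ?W "Suc (Suc k)"] by simp
        then have "wact ?M ?V (wact ?M ?W (?x # ?y)) = wact ?M ?W (wact ?M ?V (?x # ?y))"
          by (simp only: wact_append)
        then show ?thesis unfolding F W by simp
      qed
      have LR: "wact ?M ?V (x # y) = x # y" if "x \<in> {Lft, Rgt}" for x y
      proof -
        have id: "wact ?M (?W @ ?W) (x # y) = x # y" for y
          using config_word_fixes_Lft_Rgt[OF u that] by simp
        then have "wsigma ?M (?W @ ?W) x = x" "wact ?M (wdelta ?M (?W @ ?W) x) y = y" for y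
          unfolding wact_Cons by (simp_all del: wsigma_append wdelta_append)
        then show ?thesis using pow2_section[of ?M "?W @ ?W" x "Suc k"]
            pow2_trivial[of ?M "wdelta ?M (?W @ ?W) x" "Suc k" y]
          by (simp add: wact_Cons del: wsigma_append wdelta_append pow2.simps)
      qed
      have "wact ?M (pow2 ?W (Suc (Suc k))) z = z" for z
      proof (cases z)
        case (Cons x y)
        then show ?thesis unfolding pow2.simps(2)[of ?W]
        proof (cases x)
          case (Pt r d c)
          then show "wact ?M ?V z = z" using F T Cons by (cases d) simp_all
        qed (use LR Cons in simp_all)
      qed simp
      then show ?thesis by blast
    qed
  }
qed

section \<open>The automaton group\<close>

lemma states_counter_mealy:
  "states (counter_mealy P K) = (let Q = {Eps, Piv} \<union> Ctl ` {..K} \<union> Up ` {..K} \<union> Dn ` {..K}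
     in Q \<union> Lift ` Q \<union> {Swap})"
  "alphabet (counter_mealy P K) = {Lft, Rgt} \<union> {Pt q c b | q c b. q < length P}"
  by (simp_all add: counter_mealy_def Let_def)

lemma sinv_states: "p \<in> states (counter_mealy P K) \<Longrightarrow> sinv p \<in> states (counter_mealy P K)"
  by (auto simp: states_counter_mealy Let_def)

lemma out_letter_alphabet: "x \<in> alphabet (counter_mealy P K) \<Longrightarrow> out_letter P p x \<in> alphabet (counter_mealy P K)"
  by (cases p; cases x) (auto simp: states_counter_mealy)

lemma up_section_states:
  assumes "\<forall>I\<in>set P. ins_bound K I" "i \<le> K"
  shows "up_section P q c b i \<in> {Eps} \<union> Up ` {..K} \<union> Dn ` {..K}"
proof (cases "q < length P")
  case True
  then have "ins_bound K (P ! q)" using assms(1) by simp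
  then show ?thesis using assms(2) True by (cases "P ! q") (auto simp: up_section_def)
qed (simp add: up_section_def)

lemma ctl_section_states:
  assumes "ins_bound K I"
  shows "ctl_section I c b \<in> {Eps, Piv} \<union> Ctl ` {..K}"
  using assms by (cases I; cases c) auto

lemma next_state_states:
  assumes wf: "\<forall>I\<in>set P. ins_bound K I" and p: "p \<in> states (counter_mealy P K)"
  shows "next_state P p x \<in> states (counter_mealy P K)"
proof (cases p)
  case (Ctl q)
  have "ctl_section (P ! q) c b \<in> {Eps, Piv} \<union> Ctl ` {..K}" if "q < length P" for c b
    using wf that by (intro ctl_section_states) simp
  then have "ctl_section (P ! q) c b \<in> states (counter_mealy P K)" if "q < length P" for c b
    using that by (fastforce simp: states_counter_mealy Let_def)
  then show ?thesis using Ctl by (cases x) (auto simp: states_counter_mealy(1) Let_def)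
next
  case (Up i)
  then show ?thesis
    using p up_section_states[OF wf, of i] by (cases x) (auto simp: states_counter_mealy Let_def)
next
  case (Dn i)
  then have "i \<le> K" using p by (auto simp: states_counter_mealy Let_def)
  then have *: "up_section P q c b i \<in> states (counter_mealy P K)" for q c b
    using up_section_states[OF wf, of i q c b] by (auto simp: states_counter_mealy Let_def)
  have "Eps \<in> states (counter_mealy P K)" by (simp add: states_counter_mealy Let_def)
  then show ?thesis using Dn sinv_states[OF *] by (cases x) auto
next
  case (Lift p')
  then show ?thesis using p by (cases x) (auto simp: states_counter_mealy Let_def)
qed (cases x; auto simp: states_counter_mealy Let_def)+

lemma mealy_automaton_counter_mealy:
  assumes "\<forall>I\<in>set P. ins_bound K I"
  shows "mealy_automaton (counter_mealy P K)"
proof -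
  have "{Pt q c b | q c b. q < length P} \<subseteq> (\<lambda>(q, c, b). Pt q c b) ` ({..<length P} \<times> UNIV)"
  proof
    fix x assume "x \<in> {Pt q c b | q c b. q < length P}"
    then obtain q c b where "x = Pt q c b" "q < length P" by blast
    then show "x \<in> (\<lambda>(q, c, b). Pt q c b) ` ({..<length P} \<times> UNIV)"
      by (intro image_eqI[of _ _ "(q, c, b)"]) simp_all
  qed
  then have "finite {Pt q c b | q c b. q < length P}"
    by (rule finite_subset) simp
  then have "finite (alphabet (counter_mealy P K))" by (simp add: states_counter_mealy)
  moreover have "finite (states (counter_mealy P K))" by (simp add: states_counter_mealy Let_def)
  ultimately show ?thesis
    unfolding mealy_automaton_def counter_mealy_simps using next_state_states[OF assms] out_letter_alphabet by blast
qed

text \<open>States and letters are renamed by natural numbers, since the theorem asks for an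
  automaton over \<open>nat\<close>.\<close>

definition encode_mealy :: "('a::countable, 's::countable) mealy \<Rightarrow> (nat, nat) mealy" where
  "encode_mealy M = \<lparr>states = to_nat ` states M, alphabet = to_nat ` alphabet M,
     delta = (\<lambda>p x. to_nat (delta M (from_nat p) (from_nat x))),
     sigma = (\<lambda>p x. to_nat (sigma M (from_nat p) (from_nat x)))\<rparr>"

lemma act_encode_mealy:
  "act (encode_mealy M) (to_nat p) z = map to_nat (act M p (map from_nat z))"
  by (induction z arbitrary: p) (auto simp: encode_mealy_def)

lemma mealy_automaton_encode:
  "mealy_automaton M \<Longrightarrow> mealy_automaton (encode_mealy M)"
  by (auto simp: mealy_automaton_def encode_mealy_def)

lemma lists_encode_alphabet:
  "lists (alphabet (encode_mealy M)) = map to_nat ` lists (alphabet M)"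
  by (simp add: encode_mealy_def lists_image)

lemma act_lists:
  assumes "mealy_automaton M" "p \<in> states M" "z \<in> lists (alphabet M)"
  shows "act M p z \<in> lists (alphabet M)"
  using assms(2,3) by (induction z arbitrary: p) (use assms(1) in \<open>auto simp: mealy_automaton_def\<close>)

lemma wact_lists:
  assumes "mealy_automaton M" "set u \<subseteq> states M" "z \<in> lists (alphabet M)"
  shows "wact M u z \<in> lists (alphabet M)"
  using assms(2)
proof (induction u)
  case (Cons p u)
  then show ?case using act_lists[OF assms(1), of p] by simp
qed (use assms(3) in simp)

definition word_map :: "('a::countable, 's::countable) mealy \<Rightarrow> 'a list \<Rightarrow> nat list \<Rightarrow> nat list" where
  "word_map M u = (\<lambda>z\<in>lists (alphabet (encode_mealy M)). map to_nat (wact M u (map from_nat z)))"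

lemma word_map_eq_iff:
  "word_map M u = word_map M v \<longleftrightarrow> (\<forall>z\<in>lists (alphabet M). wact M u z = wact M v z)"
proof
  assume eq: "word_map M u = word_map M v"
  show "\<forall>z\<in>lists (alphabet M). wact M u z = wact M v z"
  proof
    fix z assume "z \<in> lists (alphabet M)"
    then have z: "map to_nat z \<in> lists (alphabet (encode_mealy M))"
      unfolding lists_encode_alphabet by blast
    from eq have "word_map M u (map to_nat z) = word_map M v (map to_nat z)" by simp
    then have "map to_nat (wact M u z) = map to_nat (wact M v z)"
      using z by (simp add: word_map_def comp_def del: in_lists_conv_set)
    then show "wact M u z = wact M v z"
      by (simp add: inj_map_eq_map)
  qed
next
  assume "\<forall>z\<in>lists (alphabet M). wact M u z = wact M v z"
  then show "word_map M u = word_map M v"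
    unfolding word_map_def lists_encode_alphabet by (intro restrict_ext) (auto simp: comp_def simp del: in_lists_conv_set)
qed

locale counter_automaton =
  fixes P :: "ins list" and K :: nat
  assumes wf: "\<forall>I\<in>set P. ins_bound K I"
begin

abbreviation "M \<equiv> counter_mealy P K"
abbreviation "N \<equiv> encode_mealy M"
abbreviation "G \<equiv> automaton_group N"
abbreviation "gen p \<equiv> word_map M [p]"

lemma automaton: "mealy_automaton M"
  by (rule mealy_automaton_counter_mealy[OF wf])

lemma automaton_N: "mealy_automaton N"
  by (rule mealy_automaton_encode[OF automaton])

lemma invertible: "invertible_mealy N"
  unfolding invertible_mealy_def
proof
  fix p' assume "p' \<in> states N"
  then obtain p where p: "p \<in> states M" "p' = to_nat p" by (auto simp: encode_mealy_def)
  show "bij_betw (act N p') (lists (alphabet N)) (lists (alphabet N))"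
  proof (rule bij_betw_byWitness[where f' = "act N (to_nat (sinv p))"])
    show "\<forall>a\<in>lists (alphabet N). act N (to_nat (sinv p)) (act N p' a) = a"
      unfolding p(2) act_encode_mealy lists_encode_alphabet by (auto simp: comp_def simp del: in_lists_conv_set)
    show "\<forall>a\<in>lists (alphabet N). act N p' (act N (to_nat (sinv p)) a) = a"
      unfolding p(2) act_encode_mealy lists_encode_alphabet by (auto simp: comp_def simp del: in_lists_conv_set)
    have "to_nat p \<in> states N" "to_nat (sinv p) \<in> states N"
      using p(1) sinv_states by (auto simp: encode_mealy_def)
    then show "act N p' ` lists (alphabet N) \<subseteq> lists (alphabet N)"
      "act N (to_nat (sinv p)) ` lists (alphabet N) \<subseteq> lists (alphabet N)"
      using act_lists[OF automaton_N] p(2) by blast+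
  qed
qed

lemma state_maps_eq: "state_maps N = gen ` states M"
proof -
  have "restrict (act N (to_nat p)) (lists (alphabet N)) = gen p" for p
    unfolding word_map_def by (intro restrict_ext) (simp add: act_encode_mealy)
  moreover have "states N = to_nat ` states M" by (simp add: encode_mealy_def)
  ultimately show ?thesis unfolding state_maps_def by (simp add: image_image)
qed

lemma group_G: "group G"
  by (rule group_automaton_group[OF automaton_N invertible])

lemma gen_carrier: "p \<in> states M \<Longrightarrow> gen p \<in> carrier G"
  unfolding automaton_group_def using state_maps_eq by (auto intro: generate.incl)

text \<open>The product of \<open>BijGroup\<close> is composition only on \<open>Bij\<close>, so
  \<open>mult_G\<close> needs this membership to unfold it.\<close>

lemma carrier_Bij: "carrier G \<subseteq> Bij (lists (alphabet N))"
proof -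
  have "carrier G \<subseteq> carrier (tree_Aut (alphabet N))"
    using group.generate_incl[OF group_tree_Aut state_maps_tree_Aut[OF automaton_N invertible]]
    by (simp add: automaton_group_def)
  then show ?thesis by (auto simp: tree_Aut_def tree_automorphisms_def)
qed

lemma one_G: "\<one>\<^bsub>G\<^esub> = word_map M []"
  unfolding word_map_def lists_encode_alphabet
  by (auto simp: automaton_group_def tree_Aut_def BijGroup_def lists_encode_alphabet comp_def
      simp del: in_lists_conv_set intro!: restrict_ext)

text \<open>Membership in the carrier is assumed here because \<open>word_map_carrier\<close> is
  itself derived from this lemma by induction; \<open>mult_word_map\<close> then discharges
  it.\<close>

lemma mult_G:
  assumes "set u \<subseteq> states M" "set v \<subseteq> states M" "word_map M u \<in> carrier G" "word_map M v \<in> carrier G"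
  shows "word_map M u \<otimes>\<^bsub>G\<^esub> word_map M v = word_map M (u @ v)"
proof -
  have "word_map M u \<otimes>\<^bsub>G\<^esub> word_map M v = compose (lists (alphabet N)) (word_map M u) (word_map M v)"
    using assms(3,4) carrier_Bij
    by (auto simp: automaton_group_def tree_Aut_def BijGroup_def)
  also have "\<dots> = word_map M (u @ v)"
    unfolding compose_def word_map_def lists_encode_alphabet
  proof (intro restrict_ext)
    fix z' assume "z' \<in> map to_nat ` lists (alphabet M)"
    then obtain z where z: "z' = map to_nat z" "z \<in> lists (alphabet M)" by blast
    then have "map to_nat (wact M v z) \<in> map to_nat ` lists (alphabet M)"
      using wact_lists[OF automaton assms(2)] by blast
    then show "(\<lambda>z\<in>map to_nat ` lists (alphabet M). map to_nat (wact M u (map from_nat z)))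
        ((\<lambda>z\<in>map to_nat ` lists (alphabet M). map to_nat (wact M v (map from_nat z))) z') =
      map to_nat (wact M (u @ v) (map from_nat z'))"
      using z by (simp add: comp_def del: in_lists_conv_set)
  qed
  finally show ?thesis .
qed

lemma word_map_carrier: "set u \<subseteq> states M \<Longrightarrow> word_map M u \<in> carrier G"
proof (induction u)
  case Nil
  then show ?case using monoid.one_closed[OF group.is_monoid[OF group_G]] one_G by simp
next
  case (Cons p u)
  then have "gen p \<otimes>\<^bsub>G\<^esub> word_map M u \<in> carrier G"
    using gen_carrier[of p] by (intro monoid.m_closed[OF group.is_monoid[OF group_G]]) auto
  also have "gen p \<otimes>\<^bsub>G\<^esub> word_map M u = word_map M (p # u)"
    using mult_G[of "[p]" u] Cons gen_carrier[of p] by simp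
  finally show ?case .
qed

lemma mult_word_map:
  "set u \<subseteq> states M \<Longrightarrow> set v \<subseteq> states M \<Longrightarrow>
    word_map M u \<otimes>\<^bsub>G\<^esub> word_map M v = word_map M (u @ v)"
  by (simp add: mult_G word_map_carrier)

lemma winv_states: "set u \<subseteq> states M \<Longrightarrow> set (winv u) \<subseteq> states M"
  using sinv_states by (auto simp: set_winv)

lemma inv_word_map:
  assumes "set u \<subseteq> states M"
  shows "inv\<^bsub>G\<^esub> word_map M u = word_map M (winv u)"
proof (rule group.inv_equality[OF group_G])
  have "word_map M (winv u @ u) = word_map M []" by (simp add: word_map_eq_iff)
  then show "word_map M (winv u) \<otimes>\<^bsub>G\<^esub> word_map M u = \<one>\<^bsub>G\<^esub>"
    using assms winv_states by (simp add: mult_word_map one_G)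
qed (use assms winv_states word_map_carrier in blast)+

lemma word_value_gen: "set u \<subseteq> states M \<Longrightarrow> word_value G (map gen u) = word_map M u"
proof (induction u)
  case (Cons p u)
  then show ?case using mult_word_map[of "[p]" u] by (simp add: word_value_def)
qed (simp add: word_value_def one_G)

lemma symmetric_generating_set: "finite_symmetric_generating_set G (state_maps N)"
  unfolding finite_symmetric_generating_set_def
proof (intro conjI ballI)
  show "finite (state_maps N)"
    using automaton_N by (simp add: state_maps_def mealy_automaton_def)
  show sub: "state_maps N \<subseteq> carrier G" using gen_carrier state_maps_eq by auto
  show "inv\<^bsub>G\<^esub> s \<in> state_maps N" if "s \<in> state_maps N" for s
    using that sinv_states inv_word_map[of "[_]"] unfolding state_maps_eq by auto
  \<comment> \<open>Generation inside this subgroup agrees with generation in the whole tree group,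
    where the state maps generate \<open>G\<close> by definition.\<close>
  have "subgroup (carrier G) (tree_Aut (alphabet N))"
    using group.generate_is_subgroup[OF group_tree_Aut state_maps_tree_Aut[OF automaton_N invertible]]
    by (simp add: automaton_group_def)
  from group.generate_consistent[OF group_tree_Aut sub this]
  show "generate G (state_maps N) = carrier G"
    by (simp add: automaton_group_def)
qed

end

section \<open>Iterated commutators with a swap of two subtrees\<close>

primrec commutator_word :: "state list \<Rightarrow> state list \<Rightarrow> nat \<Rightarrow> state list" where
  "commutator_word v w 0 = v"
| "commutator_word v w (Suc n) =
     winv (commutator_word v w n) @ winv w @ commutator_word v w n @ w"

text \<open>The first commutator acts as \<open>winv w\<close> and \<open>w\<close> on the two
  subtrees. If a commutator acts as \<open>u\<close> and its inverse, conjugation by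
  \<open>Swap\<close> inverts it, so the next one has \<open>winv u @ winv u\<close> in place of
  \<open>u\<close>. The sign alternates, hence the two alternatives; \<open>Suc n\<close>
  commutators yield exponent \<open>2 ^ n\<close>.\<close>

lemma commutator_word_Lift_Swap:
  "\<exists>u\<in>{pow2 w n, winv (pow2 w n)}. \<forall>z.
     wact (counter_mealy P K) (commutator_word (map Lift w) [Swap] (Suc n)) (Lft # z) = Lft # wact (counter_mealy P K) u z \<and>
     wact (counter_mealy P K) (commutator_word (map Lift w) [Swap] (Suc n)) (Rgt # z) = Rgt # wact (counter_mealy P K) (winv u) z \<and>
     (\<forall>q c b. wact (counter_mealy P K) (commutator_word (map Lift w) [Swap] (Suc n)) (Pt q c b # z) = Pt q c b # z)"
proof (induction n)
  case 0
  let ?M = "counter_mealy P K"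
  have L: "wact ?M (map Lift w) (Lft # z) = Lft # wact ?M w z" for w z
    by (induction w) auto
  have R: "wact ?M (map Lift w) (x # z) = x # z" if "x \<noteq> Lft" for w x z
    using that by (induction w) (cases x; auto)+
  have i: "winv (map Lift w) = map Lift (winv w)"
    by (simp add: winv_def rev_map comp_def)
  show ?case by (rule bexI[of _ "winv w"]) (simp_all add: L R i)
next
  case (Suc n)
  let ?M = "counter_mealy P K" and ?c = "commutator_word (map Lift w) [Swap] (Suc n)"
  obtain u where u: "u \<in> {pow2 w n, winv (pow2 w n)}"
    and L: "\<And>z. wact ?M ?c (Lft # z) = Lft # wact ?M u z"
    and R: "\<And>z. wact ?M ?c (Rgt # z) = Rgt # wact ?M (winv u) z"
    and D: "\<And>q c b z. wact ?M ?c (Pt q c b # z) = Pt q c b # z"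
    using Suc by blast
  have L': "wact ?M (winv ?c) (Lft # z) = Lft # wact ?M (winv u) z" for z
    using wact_winv[of P K ?c "Lft # wact ?M (winv u) z"] unfolding L by simp
  have R': "wact ?M (winv ?c) (Rgt # z) = Rgt # wact ?M u z" for z
    using wact_winv[of P K ?c "Rgt # wact ?M u z"] unfolding R by simp
  have D': "wact ?M (winv ?c) (Pt q k b # z) = Pt q k b # z" for q k b z
    using wact_winv[of P K ?c "Pt q k b # z"] unfolding D by simp
  have "winv u @ winv u \<in> {pow2 w (Suc n), winv (pow2 w (Suc n))}"
    using u unfolding pow2_Suc' by auto
  moreover have "commutator_word (map Lift w) [Swap] (Suc (Suc n)) = winv ?c @ [Swap] @ ?c @ [Swap]"
    by (subst commutator_word.simps(2)) simp
  ultimately show ?case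
    by (intro bexI[of _ "winv u @ winv u"]) (simp_all add: L R D L' R' D' del: commutator_word.simps)
qed

lemma commutator_word_trivial_iff:
  fixes P K
  defines "X \<equiv> alphabet (counter_mealy P K)"
  shows "(\<forall>z\<in>lists X. wact (counter_mealy P K) (commutator_word (map Lift w) [Swap] (Suc n)) z = z) \<longleftrightarrow>
    (\<forall>z\<in>lists X. wact (counter_mealy P K) (pow2 w n) z = z)"
proof -
  let ?M = "counter_mealy P K" and ?c = "commutator_word (map Lift w) [Swap] (Suc n)"
  obtain u where u: "u \<in> {pow2 w n, winv (pow2 w n)}"
    and L: "\<And>z. wact ?M ?c (Lft # z) = Lft # wact ?M u z"
    and R: "\<And>z. wact ?M ?c (Rgt # z) = Rgt # wact ?M (winv u) z"
    and D: "\<And>q c b z. wact ?M ?c (Pt q c b # z) = Pt q c b # z"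
    using commutator_word_Lift_Swap[of w n P K] by blast
  have inv: "wact ?M (winv v) z = z \<longleftrightarrow> wact ?M v z = z" for v z
    by (metis wact_winv wact_winv')
  have iff: "wact ?M u z = z \<longleftrightarrow> wact ?M (pow2 w n) z = z" for z
    using u inv by auto
  have c: "wact ?M ?c (x # z) = x # z" if "wact ?M u z = z" for x z
    using that by (cases x) (simp_all only: L R D inv list.inject simp_thms)
  show ?thesis
  proof
    assume *: "\<forall>z\<in>lists X. wact ?M ?c z = z"
    show "\<forall>z\<in>lists X. wact ?M (pow2 w n) z = z"
    proof
      fix z assume "z \<in> lists X"
      then have "Lft # z \<in> lists X" by (simp add: X_def states_counter_mealy)
      then have "wact ?M ?c (Lft # z) = Lft # z" using * by blast
      then show "wact ?M (pow2 w n) z = z" unfolding L by (simp add: iff)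
    qed
  next
    assume *: "\<forall>z\<in>lists X. wact ?M (pow2 w n) z = z"
    show "\<forall>z\<in>lists X. wact ?M ?c z = z"
    proof
      fix z assume z: "z \<in> lists X"
      show "wact ?M ?c z = z"
      proof (cases z)
        case (Cons x y)
        then have "y \<in> lists X" using z by simp
        then show ?thesis unfolding Cons using c iff * by blast
      qed simp
    qed
  qed
qed

context counter_automaton begin

lemma commutator_word_states:
  "set v \<subseteq> states M \<Longrightarrow> set w \<subseteq> states M \<Longrightarrow> set (commutator_word v w n) \<subseteq> states M"
  using winv_states by (induction n) auto

lemma iterated_commutator_word_map:
  assumes "set v \<subseteq> states M" "set w \<subseteq> states M"
  shows "iterated_commutator G (word_map M v) (word_map M w) n = word_map M (commutator_word v w n)"
proof (induction n)
  case (Suc n)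
  have c: "set (commutator_word v w n) \<subseteq> states M" by (rule commutator_word_states[OF assms])
  show ?case
    using Suc c assms(2) winv_states[OF c] winv_states[OF assms(2)]
    by (simp add: commutator_def inv_word_map mult_word_map)
qed simp

lemma engel_iff_halts:
  assumes q: "q \<le> K" and e: "encodes K u R"
  shows "(\<exists>n\<ge>1. iterated_commutator G (word_value G (map gen (map Lift (config_word q u))))
      (word_value G (map gen [Swap])) n = \<one>\<^bsub>G\<^esub>) \<longleftrightarrow> halts P (q, R)"
proof -
  let ?W = "config_word q u"
  have "set (map Lift ?W) \<subseteq> states M"
    using q e by (auto simp: config_word_def encodes_def states_counter_mealy Let_def set_winv)
  moreover have "set [Swap] \<subseteq> states M" by (simp add: states_counter_mealy Let_def)
  ultimately have "(\<exists>n\<ge>1. iterated_commutator G (word_value G (map gen (map Lift ?W)))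
      (word_value G (map gen [Swap])) n = \<one>\<^bsub>G\<^esub>) \<longleftrightarrow>
      (\<exists>n\<ge>1. word_map M (commutator_word (map Lift ?W) [Swap] n) = word_map M [])"
    by (simp only: word_value_gen iterated_commutator_word_map one_G)
  \<comment> \<open>The condition \<open>n \<ge> 1\<close> matches the shift by which
    \<open>Suc n\<close> commutators produce \<open>pow2\<close> with exponent
    \<open>n\<close>.\<close>
  also have "\<dots> \<longleftrightarrow> (\<exists>n. word_map M (commutator_word (map Lift ?W) [Swap] (Suc n)) = word_map M [])"
    by (metis Suc_le_D One_nat_def le_add1 plus_1_eq_Suc)
  also have "\<dots> \<longleftrightarrow> (\<exists>n. \<forall>z\<in>lists (alphabet M). wact M (pow2 ?W n) z = z)"
    by (simp only: word_map_eq_iff wact.simps(1) commutator_word_trivial_iff)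
  also have "\<dots> \<longleftrightarrow> halts P (q, R)"
    using pow2_order_imp_halts[OF wf e] halts_imp_pow2_order[OF wf e] unfolding halts_def by blast
  finally show ?thesis .
qed

end

section \<open>The diagonal argument\<close>

text \<open>Every register other than \<open>1\<close> and \<open>2\<close> is 0 and so is
  represented by one letter.\<close>

definition input_word :: "nat \<Rightarrow> nat \<Rightarrow> nat \<Rightarrow> state list" where
  "input_word K x y = replicate (2 ^ x) (Up 1) @ replicate (2 ^ y) (Up 2) @
     map Up (filter (\<lambda>i. i \<noteq> 1 \<and> i \<noteq> 2) [0..<Suc K])"

lemma encodes_input_word:
  assumes "2 \<le> K"
  shows "encodes K (input_word K x y) (input x y)"
proof -
  have rep: "count_list (replicate n p) q = (if p = q then n else 0)" for n and p q :: state
    by (induction n) auto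
  have cnt: "count_list (map Up is) (Up i) = count_list is i" for "is" i
    by (induction "is") auto
  have dist: "distinct is \<Longrightarrow> count_list is i = (if i \<in> set is then 1 else 0)" for "is" and i :: nat
    by (induction "is") auto
  show ?thesis using assms
    by (auto simp: encodes_def input_word_def input_def rep cnt dist simp del: upt_Suc)
qed

lemma recursive_list_encode_append:
  "recursive n (\<lambda>xs. list_encode (w xs)) \<Longrightarrow> recursive n (\<lambda>xs. list_encode (u @ w xs))"
  by (induction u) (simp_all add: recursive_intros)

text \<open>Prefixing a letter to a list is a fixed recursive map on codes, and its iteration is a
  primitive recursion.\<close>

lemma recursive_list_encode_replicate:
  assumes "recursive n F" "recursive n (\<lambda>xs. list_encode (w xs))"
  shows "recursive n (\<lambda>xs. list_encode (replicate (F xs) a @ w xs))"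
proof -
  define h where "h k y = ((\<lambda>r. Suc (prod_encode (a, r))) ^^ k) y" for k y
  have "recursive n (\<lambda>xs. h (F xs) (list_encode (w xs)))"
    by (rule recursive_prec2[where h = h and f = "\<lambda>y. y" and g = "\<lambda>k r y. Suc (prod_encode (a, r))"])
      (use assms in \<open>simp_all add: recursive_intros h_def\<close>)
  moreover have "h k (list_encode l) = list_encode (replicate k a @ l)" for k l
    by (induction k) (simp_all add: h_def)
  ultimately show ?thesis by simp
qed

text \<open>Only the numbers of repetitions depend on the input. The numbering \<open>f\<close> may
  be any function, because only finitely many of its values enter, as constants.\<close>

lemma recursive_input_word:
  "recursive 2 (\<lambda>xs. list_encode (map f (map Lift (config_word 0 (input_word K (xs ! 0) (xs ! 1))))))"
proof -
  let ?u = "map Up (filter (\<lambda>i. i \<noteq> 1 \<and> i \<noteq> 2) [0..<Suc K])"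
  have word: "map f (map Lift (config_word 0 (input_word K x y))) =
      map f (map Lift (Ctl 0 # winv ?u)) @ replicate (2 ^ y) (f (Lift (Dn 2))) @
      replicate (2 ^ x) (f (Lift (Dn 1))) @ [f (Lift Piv)] @ replicate (2 ^ x) (f (Lift (Up 1))) @
      replicate (2 ^ y) (f (Lift (Up 2))) @ map f (map Lift ?u)" for x y
    by (simp add: config_word_def input_word_def winv_def[of "replicate _ _"] del: upt_Suc)
  have "recursive 2 (\<lambda>xs. list_encode (map f (map Lift ?u)))" by (rule recursive_const)
  then show ?thesis unfolding word
    by (intro recursive_list_encode_append recursive_list_encode_replicate recursive_intros) simp_all
qed

lemma ins_bound_mono: "ins_bound K I \<Longrightarrow> K \<le> L \<Longrightarrow> ins_bound L I"
  by (cases I) auto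

lemma ex_ins_bound: "\<exists>K. \<forall>I\<in>set P. ins_bound K I"
proof (induction P)
  case (Cons I P)
  then obtain K where K: "\<forall>J\<in>set P. ins_bound K J" by blast
  obtain L where "ins_bound L I"
  proof (cases I)
    case (Inc i q)
    then show ?thesis using that[of "i + q"] by simp
  next
    case (Cpy i j q)
    then show ?thesis using that[of "i + j + q"] by simp
  next
    case (Dec i q q')
    then show ?thesis using that[of "i + q + q'"] by simp
  qed
  then show ?case using K ins_bound_mono
    by (intro exI[of _ "max K L"]) (auto intro: ins_bound_mono)
qed simp

lemma halts_funpow_iff: "halts P ((step P ^^ m) c) \<longleftrightarrow> halts P c"
proof
  assume "halts P ((step P ^^ m) c)"
  then obtain k where "length P \<le> fst ((step P ^^ k) ((step P ^^ m) c))" unfolding halts_def by blast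
  then have "length P \<le> fst ((step P ^^ (k + m)) c)" by (simp add: funpow_add)
  then show "halts P c" unfolding halts_def by blast
next
  assume "halts P c"
  then obtain k where k: "length P \<le> fst ((step P ^^ k) c)" unfolding halts_def by blast
  have "(step P ^^ k) ((step P ^^ m) c) = (step P ^^ m) ((step P ^^ k) c)"
    by (metis add.commute comp_apply funpow_add)
  then have "length P \<le> fst ((step P ^^ k) ((step P ^^ m) c))"
    using k funpow_step_halted[OF k] by simp
  then show "halts P ((step P ^^ m) c)" unfolding halts_def by blast
qed

text \<open>Inputs are in registers \<open>1\<close> and \<open>2\<close>, the output in
  \<open>3\<close>, and scratch space starts at \<open>4\<close>.\<close>

lemma ex_flat_program:
  "\<exists>c. \<forall>x y z. rec_eval f [x, y] z \<longrightarrow> (\<exists>R. exec c (input x y) R \<and> R 3 = z)"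
proof -
  obtain c where c: "computes f [1, 2] 3 4 c" using ex_computes[of "[1, 2]" 4 3 f] by auto
  have "\<exists>R. exec c (input x y) R \<and> R 3 = z" if "rec_eval f [x, y] z" for x y z
  proof -
    have "rec_eval f (map (input x y) [1, 2]) z" "input x y 0 = 0"
      using that by (simp_all add: input_def)
    from computesD[OF c this] show ?thesis by blast
  qed
  then show ?thesis by blast
qed

text \<open>The appended loop decrements register \<open>3\<close> and then restores it, so it runs
  forever unless the register is 0.\<close>

lemma halts_guarded_iff:
  assumes "exec c R R'"
  defines "P \<equiv> flatten (Seq c (Loop 3 (CInc 3))) 0 (com_size c + 2)"
  shows "halts P (0, R) \<longleftrightarrow> R' 3 = 0"
proof -
  let ?p = "com_size c"
  have P: "P = [] @ flatten c (length []) ?p @ [Dec 3 (?p + 2) (Suc ?p), Inc 3 ?p]"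
    by (simp add: P_def)
  have len: "length P = ?p + 2" by (simp add: P_def)
  have nth: "P ! ?p = Dec 3 (?p + 2) (Suc ?p)" "P ! Suc ?p = Inc 3 ?p"
    by (simp_all add: P_def nth_append)
  obtain k where "(step P ^^ k) (0, R) = (?p, R')"
    using flatten_exec[OF assms(1) P] by auto
  then have iff: "halts P (0, R) \<longleftrightarrow> halts P (?p, R')" using halts_funpow_iff by metis
  show ?thesis
  proof (cases "R' 3")
    case 0
    then have "fst ((step P ^^ 1) (?p, R')) = length P" using nth len by simp
    then have "halts P (?p, R')" unfolding halts_def by (metis order_refl)
    then show ?thesis using iff 0 by simp
  next
    case (Suc v)
    have "(step P ^^ n) (?p, R') \<in> {(?p, R'), (Suc ?p, R'(3 := v))}" for n
    proof (induction n)
      case (Suc n)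
      have "step P (?p, R') = (Suc ?p, R'(3 := v))" using nth len \<open>R' 3 = Suc v\<close> by simp
      moreover have "step P (Suc ?p, R'(3 := v)) = (?p, R')"
        using nth len \<open>R' 3 = Suc v\<close> by (simp add: fun_upd_idem)
      ultimately show ?case using Suc by (auto simp del: step.simps fun_upd_apply)
    qed simp
    then have "fst ((step P ^^ n) (?p, R')) < length P" for n
      using len by (metis (no_types, lifting) fst_conv insertE lessI less_add_Suc1 add_2_eq_Suc' less_SucI singletonD)
    then have "\<not> halts P (?p, R')" unfolding halts_def by (simp add: not_le)
    then show ?thesis using iff Suc by simp
  qed
qed

theorem theorem1p2:
  shows "\<exists>(M :: (nat, nat) mealy) S.
           mealy_automaton M \<and> invertible_mealy M \<and>
           finite_symmetric_generating_set (automaton_group M) S \<and>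
           \<not> engel_problem_decidable (automaton_group M) S"
proof -
  obtain U where U: "\<forall>P K e k q R. (\<forall>I\<in>set P. ins_bound K I) \<longrightarrow> 3 \<le> K \<longrightarrow> K < e \<longrightarrow>
     (step P ^^ k) (0, input (program_code e P) e) = (q, R) \<longrightarrow> length P \<le> q \<longrightarrow>
     rec_eval U [program_code e P, e] (R 3)"
    using ex_universal by blast
  obtain c where c: "\<forall>x y z. rec_eval U [x, y] z \<longrightarrow> (\<exists>R. exec c (input x y) R \<and> R 3 = z)"
    using ex_flat_program by blast
  define P where "P = flatten (Seq c (Loop 3 (CInc 3))) 0 (com_size c + 2)"
  obtain K0 where "\<forall>I\<in>set P. ins_bound K0 I" using ex_ins_bound by blast
  then have "\<forall>I\<in>set P. ins_bound (K0 + 2) I" using ins_bound_mono by fastforce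
  \<comment> \<open>\<open>K\<close> must be at least 2 so that \<open>Up 1\<close> and
    \<open>Up 2\<close>, the letters of the input registers, are states.\<close>
  then obtain K where K: "2 \<le> K" "\<forall>I\<in>set P. ins_bound K I" by (metis le_add2)
  interpret counter_automaton P K by unfold_locales (rule K(2))
  define v where "v x y = map gen (map Lift (config_word 0 (input_word K x y)))" for x y
  define w where "w = map gen [Swap]"
  define engel where "engel v w \<longleftrightarrow>
    (\<exists>n\<ge>1. iterated_commutator G (word_value G v) (word_value G w) n = \<one>\<^bsub>G\<^esub>)" for v w
  have engel: "engel (v x y) w \<longleftrightarrow> halts P (0, input x y)" for x y
    unfolding engel_def v_def w_def using encodes_input_word[OF K(1)] by (rule engel_iff_halts[OF le0])
  have lists: "v x y \<in> lists (state_maps N)" "w \<in> lists (state_maps N)" for x y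
  proof -
    have "encodes K (input_word K x y) (input x y)" by (rule encodes_input_word[OF K(1)])
    then have "set (map Lift (config_word 0 (input_word K x y))) \<subseteq> states M"
      by (auto simp: config_word_def encodes_def states_counter_mealy Let_def set_winv)
    then have "set (v x y) \<subseteq> state_maps N"
      unfolding v_def state_maps_eq list.set_map(1)[of gen] by (rule image_mono)
    then show "v x y \<in> lists (state_maps N)" by blast
    show "w \<in> lists (state_maps N)" by (simp add: w_def state_maps_eq states_counter_mealy Let_def)
  qed
  have "\<not> engel_problem_decidable G (state_maps N)"
  proof
    assume "engel_problem_decidable G (state_maps N)"
    then obtain a d where "\<forall>v\<in>lists (state_maps N). \<forall>w\<in>lists (state_maps N).
        rec_eval d [list_encode (map a v), list_encode (map a w)] (if engel v w then 1 else 0)"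
      unfolding engel_problem_decidable_def decidable_word_rel_def engel_def by blast
    then have d: "rec_eval d [list_encode (map a (v x y)), list_encode (map a w)]
        (if engel (v x y) w then 1 else 0)" for x y
      using lists by blast
    have "recursive 2 (\<lambda>xs. list_encode (map a (v (xs ! 0) (xs ! 1))))"
      unfolding v_def map_map[of a] by (rule recursive_input_word)
    then obtain e1 where "\<forall>xs. length xs = 2 \<longrightarrow> rec_eval e1 xs (list_encode (map a (v (xs ! 0) (xs ! 1))))"
      unfolding recursive_def by blast
    then have e1: "rec_eval e1 [x, y] (list_encode (map a (v x y)))" for x y
      by (auto dest!: spec[of _ "[x, y]"])
    obtain e2 where "\<forall>xs. length xs = 2 \<longrightarrow> rec_eval e2 xs (list_encode (map a w))"
      using recursive_const[of 2 "list_encode (map a w)"] unfolding recursive_def by blast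
    then have e2: "rec_eval e2 [x, y] (list_encode (map a w))" for x y by simp
    have h: "rec_eval (Comp d [e1, e2]) [x, y] (if engel (v x y) w then 1 else 0)" for x y
      by (rule rec_eval.comp[OF _ d]) (simp add: e1 e2)
    obtain b where b: "\<forall>x y z. rec_eval (Comp d [e1, e2]) [x, y] z \<longrightarrow> (\<exists>R. exec b (input x y) R \<and> R 3 = z)"
      using ex_flat_program by blast
    define Q where "Q = flatten b 0 (com_size b)"
    obtain L0 where "\<forall>I\<in>set Q. ins_bound L0 I" using ex_ins_bound by blast
    then have "\<forall>I\<in>set Q. ins_bound (L0 + 3) I" using ins_bound_mono by fastforce
    then obtain L where L: "3 \<le> L" "\<forall>I\<in>set Q. ins_bound L I" by (metis le_add2)
    \<comment> \<open>\<open>Q\<close> computes the verdict of the supposed decision procedure on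
      \<open>v x y\<close> and \<open>w\<close>. It is now given its own code, in a base exceeding
      the bound \<open>L\<close> on its entries.\<close>
    let ?x = "program_code (Suc L) Q" and ?y = "Suc L"
    let ?r = "if engel (v ?x ?y) w then 1 else 0 :: nat"
    obtain R where R: "exec b (input ?x ?y) R" "R 3 = ?r" using b h by blast
    obtain k where "(step Q ^^ k) (0, input ?x ?y) = (com_size b, R)"
      using flatten_exec[OF R(1), of Q "[]" "com_size b" "[]"] by (auto simp: Q_def)
    moreover have "length Q \<le> com_size b" by (simp add: Q_def)
    ultimately have "rec_eval U [?x, ?y] (R 3)"
      using U L lessI[of L] by blast
    then have "rec_eval U [?x, ?y] ?r" unfolding R(2) .
    then obtain R' where R': "exec c (input ?x ?y) R'" "R' 3 = ?r" using c by blast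
    \<comment> \<open>\<open>U\<close> reproduces the verdict of \<open>Q\<close>, and
      \<open>P\<close> halts iff this verdict is 0. By \<open>engel\<close> the verdict is 1 iff
      \<open>P\<close> halts on this very input, a contradiction.\<close>
    from halts_guarded_iff[OF R'(1)] have "halts P (0, input ?x ?y) \<longleftrightarrow> ?r = 0"
      unfolding P_def R'(2) .
    then show False using engel[of ?x ?y] by (simp split: if_splits)
  qed
  then show ?thesis using automaton_N invertible symmetric_generating_set by blast
qed

end
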